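(* For a (Tychonoff) space $X$ the following are equivalent: (a) $X$ is a finite $C$-space; (b) every sequence $\{\omega_n\}_{n\in\mathbb N}$ of locally finite covers of $X$ by functionally open sets has a finite $C$-refinement $\{\gamma_n\}_{n=1}^s$ such that $\bigcup_{n=1}^s\gamma_n$ is a locally finite cover of $X$ consisting of functionally open sets.
   Context: A set is functionally open if it is a cozero set. A finite $C$-refinement of a sequence of covers $\{\omega_n\}$ is a finite sequence $\gamma_1,\dots,\gamma_s$ of families of open sets, each $\gamma_n$ consisting of pairwise disjoint sets and refining $\omega_n$, such that $\bigcup_{n=1}^s\gamma_n$ covers $X$. $X$ is a finite $C$-space if every sequence of finite covers of $X$ by functionally open sets has a finite $C$-refinement in which each $\gamma_n$ is a finite family of pairwise disjoint functionally open sets. *)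

theory Defs
  imports "HOL-Analysis.Analysis"
begin

definition functionally_open :: "'a topology \<Rightarrow> 'a set \<Rightarrow> bool" where
  "functionally_open X U \<longleftrightarrow>
     (\<exists>f. continuous_map X euclideanreal f \<and> U = {x \<in> topspace X. f x \<noteq> 0})"

definition refines :: "'a set set \<Rightarrow> 'a set set \<Rightarrow> bool" where
  "refines \<gamma> \<omega> \<longleftrightarrow> (\<forall>V\<in>\<gamma>. \<exists>U\<in>\<omega>. V \<subseteq> U)"

text \<open>A finite C-refinement gamma_0, ..., gamma_(s-1) of the sequence omega
  (indices shifted to start at 0).\<close>
definition finite_C_refinement ::
    "'a topology \<Rightarrow> (nat \<Rightarrow> 'a set set) \<Rightarrow> nat \<Rightarrow> (nat \<Rightarrow> 'a set set) \<Rightarrow> bool" where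
  "finite_C_refinement X \<omega> s \<gamma> \<longleftrightarrow>
     (\<forall>n<s. (\<forall>V\<in>\<gamma> n. openin X V) \<and> pairwise disjnt (\<gamma> n) \<and> refines (\<gamma> n) (\<omega> n)) \<and>
     topspace X \<subseteq> \<Union>(\<Union>n<s. \<gamma> n)"

definition finite_C_space :: "'a topology \<Rightarrow> bool" where
  "finite_C_space X \<longleftrightarrow>
     (\<forall>\<omega>::nat \<Rightarrow> 'a set set.
        (\<forall>n. finite (\<omega> n) \<and> (\<forall>U\<in>\<omega> n. functionally_open X U) \<and> \<Union>(\<omega> n) = topspace X)
        \<longrightarrow> (\<exists>s \<gamma>. finite_C_refinement X \<omega> s \<gamma> \<and>
               (\<forall>n<s. finite (\<gamma> n) \<and> (\<forall>V\<in>\<gamma> n. functionally_open X V))))"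

end

theory Submission
  imports Defs
begin

text \<open>Let \<open>X\<close> be a finite C-space and \<open>\<omega>\<close> a locally finite functionally open cover. Barycentric stars
  of equal dimension in the nerve of \<open>\<omega>\<close> are disjoint, so \<open>\<omega>\<close> may be replaced by a countable cover
  \<open>{W k}\<close> with a function \<open>g\<close> such that each \<open>{g < j}\<close> lies in finitely many \<open>W k\<close>. A diagonal
  argument over the slabs \<open>{i \<le> g \<le> i + 1}\<close> shows that some tail \<open>{g \<ge> J}\<close> is finite-dimensional:
  any \<open>m\<close> binary covers have disjoint shrinkings covering the even (or the odd) slabs of the tail.
  Such sets are covered by finitely many disjoint refinements of arbitrary locally finite covers.
  Now apply the finite C-property to the finite covers \<open>{W k | k \<le> J} \<union> {{g > J}}\<close> obtained from the
  members of the given sequence; the finitely many tails left over use up finitely many further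
  members.\<close>

section \<open>Functionally open sets and locally finite sums\<close>

text \<open>The obstacle is that the length \<open>s\<close> supplied by the finite C-property
  depends on the whole sequence of covers, so one application bounds nothing uniformly. The diagonal
  argument defeats this by letting the n-th bad slab carry n binary covers: whatever
  \<open>s\<close> comes back, some slab carries a system of exactly that size which was chosen to
  admit no solution. Gluing works only over slabs separated by gaps, hence the parities.
  Finite-dimensionality is expressed by real functions with thresholds rather than by sets, because
  functions can be multiplied by cutoffs with values in [0, 1] without violating the constraints.
  The bound obtained for a tail does not depend on the covers; this uniformity allows the missing
  part to be covered by later members of the same sequence.\<close>

lemma continuous_map_locally_equal:
  assumes "\<And>x. x \<in> topspace X \<Longrightarrow>
    \<exists>U g. openin X U \<and> x \<in> U \<and> continuous_map X euclideanreal g \<and> (\<forall>y\<in>U. f y = g y)"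
  shows "continuous_map X euclideanreal f"
  unfolding continuous_map_def
proof (intro conjI allI impI)
  fix S :: "real set"
  assume S: "openin euclideanreal S"
  show "openin X {x \<in> topspace X. f x \<in> S}"
  proof (subst openin_subopen, intro ballI)
    fix x assume x: "x \<in> {x \<in> topspace X. f x \<in> S}"
    then obtain U g where U: "openin X U" "x \<in> U" "continuous_map X euclideanreal g"
      "\<forall>y\<in>U. f y = g y"
      using assms by blast
    have "openin X (U \<inter> {y \<in> topspace X. g y \<in> S})"
      using U S openin_continuous_map_preimage by blast
    moreover have "U \<inter> {y \<in> topspace X. g y \<in> S} \<subseteq> {x \<in> topspace X. f x \<in> S}"
      using U by auto
    moreover have "x \<in> U \<inter> {y \<in> topspace X. g y \<in> S}"
      using U x by auto
    ultimately show "\<exists>T. openin X T \<and> x \<in> T \<and> T \<subseteq> {x \<in> topspace X. f x \<in> S}"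
      by blast
  qed
qed auto

text \<open>Near each point only a fixed finite set of summands is nonzero, so the sum agrees there
  with a finite one. \<open>supp_sum\<close> adds over the support only, which gives a value for
  infinite \<open>I\<close>.\<close>

lemma continuous_map_supp_sum:
  fixes f :: "'i \<Rightarrow> 'a \<Rightarrow> real"
  assumes cont: "\<And>i. i \<in> I \<Longrightarrow> continuous_map X euclideanreal (f i)"
    and lf: "\<And>x. x \<in> topspace X \<Longrightarrow>
      \<exists>U. openin X U \<and> x \<in> U \<and> finite {i \<in> I. \<exists>y\<in>U. f i y \<noteq> 0}"
  shows "continuous_map X euclideanreal (\<lambda>x. supp_sum (\<lambda>i. f i x) I)"
proof (rule continuous_map_locally_equal)
  fix x assume "x \<in> topspace X"
  then obtain U where U: "openin X U" "x \<in> U" and fin: "finite {i \<in> I. \<exists>y\<in>U. f i y \<noteq> 0}"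
    using lf by blast
  define J where "J = {i \<in> I. \<exists>y\<in>U. f i y \<noteq> 0}"
  have "continuous_map X euclideanreal (\<lambda>x. \<Sum>i\<in>J. f i x)"
    using fin by (intro continuous_map_sum) (auto simp: J_def cont)
  moreover have "supp_sum (\<lambda>i. f i y) I = (\<Sum>i\<in>J. f i y)" if "y \<in> U" for y
    unfolding supp_sum_def
    by (rule sum.mono_neutral_left) (use fin that in \<open>auto simp: J_def support_on_def\<close>)
  ultimately show "\<exists>U g. openin X U \<and> x \<in> U \<and> continuous_map X euclideanreal g \<and>
      (\<forall>y\<in>U. supp_sum (\<lambda>i. f i y) I = g y)"
    using U by blast
qed

lemma sum_le_supp_sum:
  fixes f :: "'i \<Rightarrow> real"
  assumes "\<And>i. 0 \<le> f i" "finite (support_on I f)" "finite A" "A \<subseteq> I"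
  shows "sum f A \<le> supp_sum f I"
proof -
  have "sum f A = sum f (A \<inter> support_on I f)"
    by (rule sum.mono_neutral_right) (use assms in \<open>auto simp: support_on_def\<close>)
  also have "\<dots> \<le> sum f (support_on I f)"
    by (rule sum_mono2) (use assms in auto)
  finally show ?thesis by (simp add: supp_sum_def)
qed

lemma locally_finite_inE:
  assumes "locally_finite_in X \<A>" "x \<in> topspace X"
  obtains N where "openin X N" "x \<in> N" "finite {U \<in> \<A>. U \<inter> N \<noteq> {}}"
  using assms unfolding locally_finite_in_def by blast

section \<open>Cozero sets: witnesses, finite intersections, locally finite unions\<close>

lemma functionally_open_positive:
  assumes "continuous_map X euclideanreal f"
  shows "functionally_open X {x \<in> topspace X. 0 < f x}"
  unfolding functionally_open_def
proof (intro exI conjI)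
  show "continuous_map X euclideanreal (\<lambda>x. max 0 (f x))"
    using assms by (intro continuous_map_real_max) auto
qed (auto simp: max_def)

lemma functionally_openE:
  assumes "functionally_open X U"
  obtains f where "continuous_map X euclideanreal f" "\<And>x. 0 \<le> f x"
    "U = {x \<in> topspace X. 0 < f x}"
proof -
  obtain f where f: "continuous_map X euclideanreal f" "U = {x \<in> topspace X. f x \<noteq> 0}"
    using assms functionally_open_def by metis
  have "continuous_map X euclideanreal (\<lambda>x. \<bar>f x\<bar>)"
    using f(1) by (rule continuous_map_real_abs)
  then show ?thesis
    by (rule that) (use f in auto)
qed

lemma functionally_open_openin: "functionally_open X U \<Longrightarrow> openin X U"
proof -
  assume "functionally_open X U"
  then obtain f where f: "continuous_map X euclideanreal f" "U = {x \<in> topspace X. f x \<noteq> 0}"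
    using functionally_open_def by metis
  show ?thesis
    using openin_continuous_map_preimage[OF f(1), of "- {0}"] by (simp add: f(2) open_Compl)
qed

lemma functionally_open_subset: "functionally_open X U \<Longrightarrow> U \<subseteq> topspace X"
  by (meson functionally_open_openin openin_subset)

lemma functionally_open_topspace: "functionally_open X (topspace X)"
  using functionally_open_positive[of X "\<lambda>_. 1"] by simp

lemma functionally_open_Int:
  assumes "functionally_open X U" "functionally_open X V"
  shows "functionally_open X (U \<inter> V)"
proof -
  obtain f where f: "continuous_map X euclideanreal f" "U = {x \<in> topspace X. f x \<noteq> 0}"
    using assms(1) unfolding functionally_open_def by blast
  obtain g where g: "continuous_map X euclideanreal g" "V = {x \<in> topspace X. g x \<noteq> 0}"
    using assms(2) unfolding functionally_open_def by blast
  have "continuous_map X euclideanreal (\<lambda>x. f x * g x)"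
    by (intro continuous_map_real_mult f(1) g(1))
  moreover have "U \<inter> V = {x \<in> topspace X. f x * g x \<noteq> 0}"
    unfolding f(2) g(2) by auto
  ultimately show ?thesis
    unfolding functionally_open_def by blast
qed

lemma functionally_open_finite_positive:
  assumes "finite A" "\<And>a. a \<in> A \<Longrightarrow> continuous_map X euclideanreal (f a)"
  shows "functionally_open X {x \<in> topspace X. \<forall>a\<in>A. 0 < f a x}"
  using assms
proof (induction A)
  case empty
  then show ?case using functionally_open_topspace by simp
next
  case (insert a A)
  have "{x \<in> topspace X. \<forall>a\<in>insert a A. 0 < f a x} =
      {x \<in> topspace X. 0 < f a x} \<inter> {x \<in> topspace X. \<forall>a\<in>A. 0 < f a x}"
    by auto
  then show ?case
    using insert by (simp add: functionally_open_Int functionally_open_positive)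
qed

text \<open>Nonnegative witnesses cannot cancel, so their sum vanishes exactly off the union; local
  finiteness makes this sum continuous.\<close>

lemma functionally_open_locally_finite_Union:
  assumes lf: "locally_finite_in X \<A>" and fo: "\<And>U. U \<in> \<A> \<Longrightarrow> functionally_open X U"
  shows "functionally_open X (\<Union>\<A>)"
proof -
  have "\<forall>U\<in>\<A>. \<exists>f. continuous_map X euclideanreal f \<and> (\<forall>x. 0 \<le> f x) \<and>
      U = {x \<in> topspace X. 0 < f x}"
    using fo functionally_openE by metis
  then obtain f where f: "\<And>U. U \<in> \<A> \<Longrightarrow> continuous_map X euclideanreal (f U)"
    "\<And>U x. U \<in> \<A> \<Longrightarrow> 0 \<le> f U x"
    and eq: "\<And>U. U \<in> \<A> \<Longrightarrow> U = {x \<in> topspace X. 0 < f U x}"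
    by metis
  have f3: "x \<in> U \<longleftrightarrow> x \<in> topspace X \<and> 0 < f U x" if "U \<in> \<A>" for U x
    using eq[OF that] by blast
  have fin: "\<exists>N. openin X N \<and> x \<in> N \<and> finite {U \<in> \<A>. \<exists>y\<in>N. f U y \<noteq> 0}"
    if x: "x \<in> topspace X" for x
  proof -
    obtain N where N: "openin X N" "x \<in> N" "finite {U \<in> \<A>. U \<inter> N \<noteq> {}}"
      using locally_finite_inE[OF lf x] by blast
    have "y \<in> U" if "U \<in> \<A>" "y \<in> N" "f U y \<noteq> 0" for U y
    proof -
      have "y \<in> topspace X" using N(1) that openin_subset by blast
      then show ?thesis using f(2)[of U y] f3[of U y] that by force
    qed
    then have "{U \<in> \<A>. \<exists>y\<in>N. f U y \<noteq> 0} \<subseteq> {U \<in> \<A>. U \<inter> N \<noteq> {}}" by auto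
    then show ?thesis using N finite_subset by blast
  qed
  have "continuous_map X euclideanreal (\<lambda>x. supp_sum (\<lambda>U. f U x) \<A>)"
    using f(1) fin by (rule continuous_map_supp_sum)
  moreover have "\<Union>\<A> = {x \<in> topspace X. supp_sum (\<lambda>U. f U x) \<A> \<noteq> 0}"
  proof (intro equalityI subsetI)
    fix x assume "x \<in> \<Union>\<A>"
    then obtain U where U: "U \<in> \<A>" "x \<in> U" by auto
    then have x: "x \<in> topspace X" "0 < f U x" using f3[of U x] by auto
    have "finite (support_on \<A> (\<lambda>U. f U x))"
      using fin[OF x(1)] by (auto simp: support_on_def elim!: rev_finite_subset)
    then have "0 < supp_sum (\<lambda>U. f U x) \<A>"
      unfolding supp_sum_def using U x f(2) by (intro sum_pos2[of _ U]) (auto simp: support_on_def)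
    then show "x \<in> {x \<in> topspace X. supp_sum (\<lambda>U. f U x) \<A> \<noteq> 0}" using x by auto
  next
    fix x assume x: "x \<in> {x \<in> topspace X. supp_sum (\<lambda>U. f U x) \<A> \<noteq> 0}"
    then obtain U where "U \<in> \<A>" "f U x \<noteq> 0"
      unfolding supp_sum_def support_on_def by (metis (mono_tags, lifting) mem_Collect_eq sum.neutral)
    then have "x \<in> U" using f(2)[of U x] f3[of U x] x by force
    then show "x \<in> \<Union>\<A>" using \<open>U \<in> \<A>\<close> by auto
  qed
  ultimately show ?thesis unfolding functionally_open_def by blast
qed

lemma functionally_open_finite_Union:
  assumes "finite \<A>" "\<And>U. U \<in> \<A> \<Longrightarrow> functionally_open X U"
  shows "functionally_open X (\<Union>\<A>)"
proof (rule functionally_open_locally_finite_Union)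
  show "locally_finite_in X \<A>"
    using assms functionally_open_subset by (intro finite_imp_locally_finite_in) blast+
qed (rule assms)

text \<open>Membership says that every weight in \<open>\<sigma>\<close> exceeds the total weight outside \<open>\<sigma>\<close>. Two distinct
  \<open>\<sigma>\<close> of the same cardinality cannot both have this property.\<close>

definition star :: "'a topology \<Rightarrow> 'i set \<Rightarrow> ('i \<Rightarrow> 'a \<Rightarrow> real) \<Rightarrow> 'i set \<Rightarrow> 'a set" where
  "star X I u \<sigma> =
     {x \<in> topspace X. \<forall>i\<in>\<sigma>. 0 < u i x + (\<Sum>j\<in>\<sigma>. u j x) - supp_sum (\<lambda>j. u j x) I}"

context
  fixes X :: "'a topology" and I :: "'i set" and u :: "'i \<Rightarrow> 'a \<Rightarrow> real"
  assumes cont: "\<And>i. i \<in> I \<Longrightarrow> continuous_map X euclideanreal (u i)"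
    and nonneg: "\<And>i x. 0 \<le> u i x"
    and lf: "\<And>x. x \<in> topspace X \<Longrightarrow>
      \<exists>U. openin X U \<and> x \<in> U \<and> finite {i \<in> I. \<exists>y\<in>U. u i y \<noteq> 0}"
begin

lemma finite_support_on: "x \<in> topspace X \<Longrightarrow> finite (support_on I (\<lambda>i. u i x))"
proof -
  assume "x \<in> topspace X"
  then obtain U where "x \<in> U" "finite {i \<in> I. \<exists>y\<in>U. u i y \<noteq> 0}" using lf by blast
  then show ?thesis by (auto simp: support_on_def elim!: rev_finite_subset)
qed

lemma functionally_open_star:
  assumes "finite \<sigma>" "\<sigma> \<subseteq> I"
  shows "functionally_open X (star X I u \<sigma>)"
proof -
  have "continuous_map X euclideanreal (\<lambda>x. supp_sum (\<lambda>j. u j x) I)"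
    by (rule continuous_map_supp_sum[OF cont lf])
  then show ?thesis
    unfolding star_def using cont assms
    by (intro functionally_open_finite_positive continuous_map_diff continuous_map_add
        continuous_map_sum) auto
qed

lemma star_positive:
  assumes "finite \<sigma>" "\<sigma> \<subseteq> I" "i \<in> \<sigma>" "x \<in> star X I u \<sigma>"
  shows "0 < u i x"
proof -
  have "x \<in> topspace X" using assms(4) by (auto simp: star_def)
  then show ?thesis
    using sum_le_supp_sum[OF nonneg finite_support_on assms(1,2)] assms(3,4)
    by (fastforce simp: star_def)
qed

lemma disjnt_star:
  assumes fin: "finite \<sigma>" "\<sigma> \<subseteq> I" "finite \<tau>" "\<tau> \<subseteq> I" and "card \<sigma> = card \<tau>" "\<sigma> \<noteq> \<tau>"
  shows "disjnt (star X I u \<sigma>) (star X I u \<tau>)"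
proof -
  have "\<not> \<sigma> \<subseteq> \<tau>" "\<not> \<tau> \<subseteq> \<sigma>"
    using assms card_subset_eq[of \<tau> \<sigma>] card_subset_eq[of \<sigma> \<tau>] by auto
  then obtain i j where i: "i \<in> \<sigma>" "i \<notin> \<tau>" and j: "j \<in> \<tau>" "j \<notin> \<sigma>"
    by blast
  have False if x\<sigma>: "x \<in> star X I u \<sigma>" and x\<tau>: "x \<in> star X I u \<tau>" for x
  proof -
    let ?S = "supp_sum (\<lambda>j. u j x) I"
    have x: "x \<in> topspace X" using x\<sigma> by (auto simp: star_def)
    have le: "(\<Sum>j\<in>A. u j x) \<le> ?S" if "finite A" "A \<subseteq> I" for A
      by (rule sum_le_supp_sum[OF nonneg finite_support_on[OF x] that])
    \<comment> \<open>Since \<open>j\<close> lies outside \<open>\<sigma>\<close> and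
      \<open>i\<close> outside \<open>\<tau>\<close>, the two memberships give
      \<open>u j x < u i x\<close> and \<open>u i x < u j x\<close>.\<close>
    have "u j x + (\<Sum>k\<in>\<sigma>. u k x) \<le> ?S"
      using le[of "insert j \<sigma>"] fin j by auto
    moreover have "u i x + (\<Sum>k\<in>\<tau>. u k x) \<le> ?S"
      using le[of "insert i \<tau>"] fin i by auto
    moreover have "?S < u i x + (\<Sum>k\<in>\<sigma>. u k x)" "?S < u j x + (\<Sum>k\<in>\<tau>. u k x)"
      using x\<sigma> x\<tau> i j by (auto simp: star_def)
    ultimately show False by linarith
  qed
  then show ?thesis by (auto simp: disjnt_def)
qed

text \<open>With all positive indices in \<open>\<sigma>\<close> no weight is left outside, so the
  star condition reduces to positivity. This is how stars are shown to cover.\<close>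

lemma in_star_positive:
  assumes x: "x \<in> topspace X"
  shows "finite {i \<in> I. 0 < u i x}" "x \<in> star X I u {i \<in> I. 0 < u i x}"
proof -
  have eq: "{i \<in> I. 0 < u i x} = support_on I (\<lambda>i. u i x)"
    using nonneg by (auto simp: support_on_def order_less_le)
  show "finite {i \<in> I. 0 < u i x}"
    unfolding eq by (rule finite_support_on[OF x])
  have "supp_sum (\<lambda>i. u i x) I = (\<Sum>i\<in>{i \<in> I. 0 < u i x}. u i x)"
    unfolding eq by (simp add: supp_sum_def)
  then show "x \<in> star X I u {i \<in> I. 0 < u i x}"
    using x by (simp add: star_def)
qed

end

section \<open>Disjoint refinements and reduction to countable covers\<close>

definition disjoint_refinement :: "'a topology \<Rightarrow> 'a set set \<Rightarrow> 'a set set \<Rightarrow> bool" where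
  "disjoint_refinement X \<omega> \<gamma> \<longleftrightarrow>
     (\<forall>V\<in>\<gamma>. functionally_open X V) \<and> pairwise disjnt \<gamma> \<and> locally_finite_in X \<gamma> \<and> refines \<gamma> \<omega>"

definition locally_finite_cover :: "'a topology \<Rightarrow> 'a set set \<Rightarrow> bool" where
  "locally_finite_cover X \<omega> \<longleftrightarrow>
     locally_finite_in X \<omega> \<and> (\<forall>U\<in>\<omega>. functionally_open X U) \<and> \<Union>\<omega> = topspace X"

text \<open>Near a point only finitely many \<open>V\<close> matter, and each brings its own
  neighbourhood meeting finitely many members of \<open>S V\<close>; finitely many neighbourhoods
  can be intersected. So local finiteness of each \<open>S V\<close> separately suffices.\<close>

lemma locally_finite_in_Int_Sigma:
  assumes \<gamma>: "locally_finite_in X \<gamma>" and S: "\<And>V. V \<in> \<gamma> \<Longrightarrow> locally_finite_in X (S V)"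
  shows "locally_finite_in X ((\<lambda>(V, T). V \<inter> T) ` (SIGMA V:\<gamma>. S V))"
  unfolding locally_finite_in_def
proof (intro conjI ballI)
  show "\<Union>((\<lambda>(V, T). V \<inter> T) ` (SIGMA V:\<gamma>. S V)) \<subseteq> topspace X"
    using \<gamma> by (auto simp: locally_finite_in_def)
  fix x assume x: "x \<in> topspace X"
  obtain N where N: "openin X N" "x \<in> N" and fin: "finite {V \<in> \<gamma>. V \<inter> N \<noteq> {}}"
    using locally_finite_inE[OF \<gamma> x] by blast
  define J where "J = {V \<in> \<gamma>. V \<inter> N \<noteq> {}}"
  have "\<forall>V\<in>J. \<exists>M. openin X M \<and> x \<in> M \<and> finite {T \<in> S V. T \<inter> M \<noteq> {}}"
    using S x by (auto simp: J_def locally_finite_in_def)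
  from bchoice[OF this] obtain M
    where "\<forall>V\<in>J. openin X (M V) \<and> x \<in> M V \<and> finite {T \<in> S V. T \<inter> M V \<noteq> {}}" ..
  then have M: "\<And>V. V \<in> J \<Longrightarrow> openin X (M V)" "\<And>V. V \<in> J \<Longrightarrow> x \<in> M V"
    "\<And>V. V \<in> J \<Longrightarrow> finite {T \<in> S V. T \<inter> M V \<noteq> {}}"
    by blast+
  define O' where "O' = N \<inter> ((\<Inter>V\<in>J. M V) \<inter> topspace X)"
  have "openin X O'"
    unfolding O'_def using fin M(1) N(1) by (intro openin_Int openin_INT) (auto simp: J_def)
  moreover have "x \<in> O'"
    using N M x by (auto simp: O'_def)
  moreover have "{P \<in> (\<lambda>(V, T). V \<inter> T) ` (SIGMA V:\<gamma>. S V). P \<inter> O' \<noteq> {}}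
      \<subseteq> (\<lambda>(V, T). V \<inter> T) ` (SIGMA V:J. {T \<in> S V. T \<inter> M V \<noteq> {}})"
  proof
    fix P assume "P \<in> {P \<in> (\<lambda>(V, T). V \<inter> T) ` (SIGMA V:\<gamma>. S V). P \<inter> O' \<noteq> {}}"
    then obtain V T y where P: "V \<in> \<gamma>" "T \<in> S V" "P = V \<inter> T" "y \<in> V" "y \<in> T" "y \<in> O'"
      by auto
    then have "V \<in> J" by (auto simp: J_def O'_def)
    then have "y \<in> M V" using P by (auto simp: O'_def)
    then show "P \<in> (\<lambda>(V, T). V \<inter> T) ` (SIGMA V:J. {T \<in> S V. T \<inter> M V \<noteq> {}})"
      using P \<open>V \<in> J\<close> by force
  qed
  moreover have "finite ((\<lambda>(V, T). V \<inter> T) ` (SIGMA V:J. {T \<in> S V. T \<inter> M V \<noteq> {}}))"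
    using fin M(3) by (intro finite_imageI finite_SigmaI) (auto simp: J_def)
  ultimately show "\<exists>W. openin X W \<and> x \<in> W \<and>
      finite {P \<in> (\<lambda>(V, T). V \<inter> T) ` (SIGMA V:\<gamma>. S V). P \<inter> W \<noteq> {}}"
    by (meson finite_subset)
qed

text \<open>Allows a different refinement on each member of \<open>\<gamma>\<close>. Pieces from
  different members are disjoint because the members are, pieces from one \<open>V\<close> because
  \<open>S V\<close> is disjoint.\<close>

lemma disjoint_refinement_Int_Sigma:
  assumes \<gamma>: "disjoint_refinement X \<omega> \<gamma>"
    and S: "\<And>V. V \<in> \<gamma> \<Longrightarrow> disjoint_refinement X \<eta> (S V)"
  shows "disjoint_refinement X \<eta> ((\<lambda>(V, T). V \<inter> T) ` (SIGMA V:\<gamma>. S V))"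
    (is "disjoint_refinement X \<eta> ?\<gamma>'")
  unfolding disjoint_refinement_def
proof (intro conjI ballI)
  show "locally_finite_in X ?\<gamma>'"
    using \<gamma> S by (intro locally_finite_in_Int_Sigma) (auto simp: disjoint_refinement_def)
  show "functionally_open X P" if "P \<in> ?\<gamma>'" for P
    using that \<gamma> S by (force simp: disjoint_refinement_def intro!: functionally_open_Int)
  show "pairwise disjnt ?\<gamma>'"
  proof (intro pairwiseI)
    fix P Q assume "P \<in> ?\<gamma>'" "Q \<in> ?\<gamma>'" "P \<noteq> Q"
    then obtain V T V' T' where P: "V \<in> \<gamma>" "T \<in> S V" "P = V \<inter> T"
      and Q: "V' \<in> \<gamma>" "T' \<in> S V'" "Q = V' \<inter> T'"
      by auto
    show "disjnt P Q"
    proof (cases "V = V'")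
      case True
      then have "T \<noteq> T'" using P Q \<open>P \<noteq> Q\<close> by auto
      then have "disjnt T T'"
        using S[OF P(1)] P Q True by (auto simp: disjoint_refinement_def pairwise_def)
      then show ?thesis using P Q by (auto simp: disjnt_def)
    next
      case False
      then have "disjnt V V'"
        using \<gamma> P Q by (auto simp: disjoint_refinement_def pairwise_def)
      then show ?thesis using P Q by (auto simp: disjnt_def)
    qed
  qed
  show "refines ?\<gamma>' \<eta>"
    unfolding refines_def
  proof
    fix P assume "P \<in> ?\<gamma>'"
    then obtain V T where P: "V \<in> \<gamma>" "T \<in> S V" "P = V \<inter> T"
      by auto
    then obtain U where "U \<in> \<eta>" "T \<subseteq> U"
      using S[OF P(1)] by (auto simp: disjoint_refinement_def refines_def)
    then show "\<exists>U\<in>\<eta>. P \<subseteq> U" using P by auto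
  qed
qed

text \<open>Outside \<open>I\<close> the zero function is taken, so that nonnegativity holds at
  every index, as the star construction requires.\<close>

lemma functionally_open_family:
  assumes "\<And>i. i \<in> I \<Longrightarrow> functionally_open X (U i)"
  shows "\<exists>u. (\<forall>i\<in>I. continuous_map X euclideanreal (u i)) \<and> (\<forall>i x. 0 \<le> u i x) \<and>
    (\<forall>i\<in>I. \<forall>x. x \<in> U i \<longleftrightarrow> x \<in> topspace X \<and> 0 < u i x)"
proof -
  have "\<exists>f. (i \<in> I \<longrightarrow> continuous_map X euclideanreal f) \<and> (\<forall>x. 0 \<le> f x) \<and>
      (i \<in> I \<longrightarrow> (\<forall>x. x \<in> U i \<longleftrightarrow> x \<in> topspace X \<and> 0 < f x))" for i
  proof (cases "i \<in> I")
    case True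
    obtain f where f: "continuous_map X euclideanreal f" "\<And>x. 0 \<le> f x"
      and eq: "U i = {x \<in> topspace X. 0 < f x}"
      using functionally_openE[OF assms[OF True]] by blast
    have "x \<in> U i \<longleftrightarrow> x \<in> topspace X \<and> 0 < f x" for x
      unfolding eq by simp
    then show ?thesis using f by blast
  next
    case False
    then show ?thesis by (intro exI[of _ "\<lambda>_. 0"]) simp
  qed
  then have "\<exists>u. \<forall>i. (i \<in> I \<longrightarrow> continuous_map X euclideanreal (u i)) \<and> (\<forall>x. 0 \<le> u i x) \<and>
      (i \<in> I \<longrightarrow> (\<forall>x. x \<in> U i \<longleftrightarrow> x \<in> topspace X \<and> 0 < u i x))"
    by (intro choice allI)
  then show ?thesis by (elim ex_forward) blast
qed

text \<open>The stars of cardinality \<open>k + 1\<close> in the nerve of the cover are pairwise disjoint, and \<open>W k\<close>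
  is their union; \<open>g\<close> is the mean of the index \<open>k\<close> with respect to weights supported on the \<open>W k\<close>.\<close>

lemma countable_reduction:
  assumes \<eta>: "locally_finite_cover X \<eta>"
  obtains W :: "nat \<Rightarrow> 'a set" and g :: "'a \<Rightarrow> real" where
    "\<And>k. functionally_open X (W k)" "continuous_map X euclideanreal g"
    "\<And>x. x \<in> topspace X \<Longrightarrow> 0 \<le> g x"
    "\<And>x j. \<lbrakk>x \<in> topspace X; g x < real j\<rbrakk> \<Longrightarrow> \<exists>k<j. x \<in> W k"
    "\<And>\<gamma>. disjoint_refinement X (range W) \<gamma> \<Longrightarrow>
      \<exists>\<gamma>'. disjoint_refinement X \<eta> \<gamma>' \<and> \<Union>\<gamma>' = \<Union>\<gamma>"
proof -
  have lf\<eta>: "locally_finite_in X \<eta>" and fo: "\<And>U. U \<in> \<eta> \<Longrightarrow> functionally_open X U"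
    and cov: "\<Union>\<eta> = topspace X"
    using \<eta> by (auto simp: locally_finite_cover_def)
  have "\<exists>u. (\<forall>U\<in>\<eta>. continuous_map X euclideanreal (u U)) \<and> (\<forall>U x. 0 \<le> u U x) \<and>
      (\<forall>U\<in>\<eta>. \<forall>x. x \<in> U \<longleftrightarrow> x \<in> topspace X \<and> 0 < u U x)"
    by (rule functionally_open_family[OF fo])
  then obtain u where
    "(\<forall>U\<in>\<eta>. continuous_map X euclideanreal (u U)) \<and> (\<forall>U x. 0 \<le> u U x) \<and>
      (\<forall>U\<in>\<eta>. \<forall>x. x \<in> U \<longleftrightarrow> x \<in> topspace X \<and> 0 < u U x)" ..
  then have u: "\<And>U. U \<in> \<eta> \<Longrightarrow> continuous_map X euclideanreal (u U)" "\<And>U x. 0 \<le> u U x"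
      "\<And>U x. U \<in> \<eta> \<Longrightarrow> x \<in> U \<longleftrightarrow> x \<in> topspace X \<and> 0 < u U x"
    by blast+
  have lfu: "\<exists>N. openin X N \<and> x \<in> N \<and> finite {U \<in> \<eta>. \<exists>y\<in>N. u U y \<noteq> 0}"
    if x: "x \<in> topspace X" for x
  proof -
    obtain N where N: "openin X N" "x \<in> N" "finite {U \<in> \<eta>. U \<inter> N \<noteq> {}}"
      using locally_finite_inE[OF lf\<eta> x] by blast
    have "y \<in> U" if "U \<in> \<eta>" "y \<in> N" "u U y \<noteq> 0" for U y
      using u(3)[OF that(1), of y] u(2)[of U y] that openin_subset[OF N(1)] by force
    then have "{U \<in> \<eta>. \<exists>y\<in>N. u U y \<noteq> 0} \<subseteq> {U \<in> \<eta>. U \<inter> N \<noteq> {}}" by auto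
    then show ?thesis using N finite_subset by blast
  qed
  define V where "V = star X \<eta> u"
  have V1: "functionally_open X (V \<sigma>)" if "finite \<sigma>" "\<sigma> \<subseteq> \<eta>" for \<sigma>
    unfolding V_def by (rule functionally_open_star[OF u(1) u(2) lfu that])
  have V2: "0 < u U x" if "finite \<sigma>" "\<sigma> \<subseteq> \<eta>" "U \<in> \<sigma>" "x \<in> V \<sigma>" for \<sigma> U x
    by (rule star_positive[OF u(1) u(2) lfu that[unfolded V_def]])
  have V3: "disjnt (V \<sigma>) (V \<tau>)"
    if "finite \<sigma>" "\<sigma> \<subseteq> \<eta>" "finite \<tau>" "\<tau> \<subseteq> \<eta>" "card \<sigma> = card \<tau>" "\<sigma> \<noteq> \<tau>" for \<sigma> \<tau>
    unfolding V_def by (rule disjnt_star[OF u(1) u(2) lfu that])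
  have V4: "finite {U \<in> \<eta>. 0 < u U x}" if "x \<in> topspace X" for x
    by (rule in_star_positive[OF u(1) u(2) lfu that])
  have V5: "x \<in> V {U \<in> \<eta>. 0 < u U x}" if "x \<in> topspace X" for x
    unfolding V_def by (rule in_star_positive[OF u(1) u(2) lfu that])
  \<comment> \<open>Cardinality \<open>k + 1\<close> excludes the empty \<open>\<sigma>\<close>,
    whose star is all of \<open>X\<close>.\<close>
  define \<Sigma> where "\<Sigma> k = {\<sigma>. finite \<sigma> \<and> \<sigma> \<subseteq> \<eta> \<and> card \<sigma> = Suc k}" for k
  define S where "S k = V ` \<Sigma> k" for k
  define W where "W k = \<Union>(S k)" for k
  have VU: "V \<sigma> \<subseteq> U" if "\<sigma> \<in> \<Sigma> k" "U \<in> \<sigma>" for \<sigma> k U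
  proof
    fix y assume y: "y \<in> V \<sigma>"
    have fin: "finite \<sigma>" "\<sigma> \<subseteq> \<eta>" using that by (auto simp: \<Sigma>_def)
    have "y \<in> topspace X"
      using y by (simp add: V_def star_def)
    then show "y \<in> U"
      using V2[OF fin that(2) y] u(3)[of U y] fin that(2) by blast
  qed
  have meets: "\<sigma> \<subseteq> {U \<in> \<eta>. U \<inter> N \<noteq> {}}" if "\<sigma> \<in> \<Sigma> k" "V \<sigma> \<inter> N \<noteq> {}" for \<sigma> k N
    using VU[OF that(1)] that by (fastforce simp: \<Sigma>_def)
  have Sdis: "disjoint_refinement X \<eta> (S k)" for k
    unfolding disjoint_refinement_def
  proof (intro conjI)
    show "\<forall>P\<in>S k. functionally_open X P"
      using V1 by (auto simp: S_def \<Sigma>_def)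
    show "pairwise disjnt (S k)"
    proof (intro pairwiseI)
      fix P Q assume "P \<in> S k" "Q \<in> S k" "P \<noteq> Q"
      then obtain \<sigma> \<tau> where \<sigma>: "\<sigma> \<in> \<Sigma> k" "P = V \<sigma>" and \<tau>: "\<tau> \<in> \<Sigma> k" "Q = V \<tau>"
        by (auto simp: S_def)
      then show "disjnt P Q"
        using V3[of \<sigma> \<tau>] \<open>P \<noteq> Q\<close> by (auto simp: \<Sigma>_def)
    qed
    show "refines (S k) \<eta>"
      unfolding refines_def
    proof
      fix P assume "P \<in> S k"
      then obtain \<sigma> where \<sigma>: "\<sigma> \<in> \<Sigma> k" "P = V \<sigma>" by (auto simp: S_def)
      then have "\<sigma> \<noteq> {}" by (auto simp: \<Sigma>_def)
      then obtain U where "U \<in> \<sigma>" by auto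
      then show "\<exists>U\<in>\<eta>. P \<subseteq> U" using VU[OF \<sigma>(1)] \<sigma> by (auto simp: \<Sigma>_def)
    qed
    show "locally_finite_in X (S k)"
      unfolding locally_finite_in_def
    proof (intro conjI ballI)
      show "\<Union>(S k) \<subseteq> topspace X"
        by (auto simp: S_def V_def star_def)
      fix x assume x: "x \<in> topspace X"
      obtain N where N: "openin X N" "x \<in> N" "finite {U \<in> \<eta>. U \<inter> N \<noteq> {}}"
        using locally_finite_inE[OF lf\<eta> x] by blast
      have "{P \<in> S k. P \<inter> N \<noteq> {}} \<subseteq> V ` Pow {U \<in> \<eta>. U \<inter> N \<noteq> {}}"
        using meets unfolding S_def by blast
      then show "\<exists>N. openin X N \<and> x \<in> N \<and> finite {P \<in> S k. P \<inter> N \<noteq> {}}"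
        using N by (meson finite_Pow_iff finite_imageI finite_subset)
    qed
  qed
  have foW: "functionally_open X (W k)" for k
    using Sdis[of k] functionally_open_locally_finite_Union[of X "S k"]
    by (auto simp: W_def disjoint_refinement_def)
  obtain w where
    "(\<forall>k\<in>UNIV. continuous_map X euclideanreal (w k)) \<and> (\<forall>k x. 0 \<le> w k x) \<and>
      (\<forall>k\<in>UNIV. \<forall>x. x \<in> W k \<longleftrightarrow> x \<in> topspace X \<and> 0 < w k x)"
    using functionally_open_family[of UNIV X W, OF foW] ..
  then have w: "\<And>k. continuous_map X euclideanreal (w k)" "\<And>k x. 0 \<le> w k x"
      "\<And>k x. x \<in> W k \<longleftrightarrow> x \<in> topspace X \<and> 0 < w k x"
    by blast+
  have lfw: "\<exists>N. openin X N \<and> x \<in> N \<and> finite {k \<in> UNIV. \<exists>y\<in>N. w k y \<noteq> 0}"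
    if x: "x \<in> topspace X" for x
  proof -
    obtain N where N: "openin X N" "x \<in> N" and fin: "finite {U \<in> \<eta>. U \<inter> N \<noteq> {}}"
      using locally_finite_inE[OF lf\<eta> x] by blast
    \<comment> \<open>If \<open>W k\<close> meets \<open>N\<close>, then at least
      \<open>k + 1\<close> members of \<open>\<eta>\<close> meet \<open>N\<close>.\<close>
    have "k < card {U \<in> \<eta>. U \<inter> N \<noteq> {}}" if "y \<in> N" "w k y \<noteq> 0" for k y
    proof -
      have "y \<in> W k"
        using w(2)[of k y] w(3)[of y k] that openin_subset[OF N(1)] by force
      then obtain \<sigma> where \<sigma>: "\<sigma> \<in> \<Sigma> k" "y \<in> V \<sigma>" by (auto simp: W_def S_def)
      then have "card \<sigma> \<le> card {U \<in> \<eta>. U \<inter> N \<noteq> {}}"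
        using meets[of \<sigma> k N] that fin by (intro card_mono) auto
      then show ?thesis using \<sigma> by (auto simp: \<Sigma>_def)
    qed
    then have "{k \<in> UNIV. \<exists>y\<in>N. w k y \<noteq> 0} \<subseteq> {..<card {U \<in> \<eta>. U \<inter> N \<noteq> {}}}" by auto
    then show ?thesis using N finite_subset by blast
  qed
  have supp: "finite (support_on UNIV (\<lambda>k. w k x))" if x: "x \<in> topspace X" for x
    using lfw[OF x] by (auto simp: support_on_def elim!: rev_finite_subset)
  have covW: "\<exists>k. x \<in> W k" if x: "x \<in> topspace X" for x
  proof -
    obtain U where "U \<in> \<eta>" "x \<in> U" using cov x by blast
    then have "{U \<in> \<eta>. 0 < u U x} \<noteq> {}" using u(3) by blast
    then have "card {U \<in> \<eta>. 0 < u U x} \<noteq> 0" using V4[OF x] by simp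
    then obtain k where "card {U \<in> \<eta>. 0 < u U x} = Suc k" using not0_implies_Suc by blast
    then have "{U \<in> \<eta>. 0 < u U x} \<in> \<Sigma> k" using V4[OF x] by (auto simp: \<Sigma>_def)
    then show ?thesis using V5[OF x] by (auto simp: W_def S_def)
  qed
  define T where "T = (\<lambda>x. supp_sum (\<lambda>k. w k x) UNIV)"
  define G where "G = (\<lambda>x. supp_sum (\<lambda>k. real k * w k x) UNIV)"
  have T: "continuous_map X euclideanreal T"
    unfolding T_def using continuous_map_supp_sum[of UNIV X w] w(1) lfw by blast
  have lfG: "\<exists>N. openin X N \<and> x \<in> N \<and> finite {k \<in> UNIV. \<exists>y\<in>N. real k * w k y \<noteq> 0}"
    if x: "x \<in> topspace X" for x
  proof -
    obtain N where N: "openin X N" "x \<in> N" "finite {k \<in> UNIV. \<exists>y\<in>N. w k y \<noteq> 0}"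
      using lfw[OF x] by blast
    have "finite {k \<in> UNIV. \<exists>y\<in>N. real k * w k y \<noteq> 0}"
      using N(3) by (rule rev_finite_subset) auto
    then show ?thesis using N by blast
  qed
  have "continuous_map X euclideanreal (\<lambda>x. real k * w k x)" for k
    using w(1) by (intro continuous_map_real_mult) auto
  then have G: "continuous_map X euclideanreal G"
    unfolding G_def using continuous_map_supp_sum[of UNIV X "\<lambda>k x. real k * w k x"] lfG by blast
  have Tpos: "0 < T x" if x: "x \<in> topspace X" for x
  proof -
    obtain k where "0 < w k x" using covW[OF x] w(3) by blast
    then show ?thesis
      unfolding T_def supp_sum_def using supp[OF x] w(2)
      by (intro sum_pos2[of _ k]) (auto simp: support_on_def)
  qed
  have Geq: "G x = (\<Sum>k\<in>support_on UNIV (\<lambda>k. w k x). real k * w k x)" if x: "x \<in> topspace X" for x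
    unfolding G_def supp_sum_def
    by (rule sum.mono_neutral_left) (use supp[OF x] in \<open>auto simp: support_on_def\<close>)
  define g where "g x = G x / T x" for x
  show thesis
  proof (rule that[of W g])
    show "continuous_map X euclideanreal g"
      unfolding g_def using G T Tpos by (intro continuous_map_real_divide) force+
    show "0 \<le> g x" if "x \<in> topspace X" for x
      using Tpos[OF that] w(2) unfolding g_def Geq[OF that]
      by (intro divide_nonneg_pos sum_nonneg mult_nonneg_nonneg) auto
    show "\<exists>k<j. x \<in> W k" if x: "x \<in> topspace X" and gj: "g x < real j" for x j
    proof (rule ccontr)
      assume "\<not> (\<exists>k<j. x \<in> W k)"
      then have "j \<le> k" if "w k x \<noteq> 0" for k
        using w(2)[of k x] w(3)[of x k] x that by (meson linorder_not_less order_le_less)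
      \<comment> \<open>A mean of indices that are all at least \<open>j\<close> is at least
        \<open>j\<close>.\<close>
      then have "(\<Sum>k\<in>support_on UNIV (\<lambda>k. w k x). real j * w k x) \<le> G x"
        unfolding Geq[OF x] using w(2)
        by (intro sum_mono mult_right_mono) (auto simp: support_on_def)
      then have "real j * T x \<le> G x"
        by (simp add: T_def supp_sum_def sum_distrib_left)
      then have "real j \<le> g x"
        using Tpos[OF x] by (simp add: g_def pos_le_divide_eq)
      then show False using gj by simp
    qed
    show "\<exists>\<gamma>'. disjoint_refinement X \<eta> \<gamma>' \<and> \<Union>\<gamma>' = \<Union>\<gamma>"
      if \<gamma>: "disjoint_refinement X (range W) \<gamma>" for \<gamma>
    proof -
      have "\<forall>P\<in>\<gamma>. \<exists>k. P \<subseteq> W k"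
        using \<gamma> by (auto simp: disjoint_refinement_def refines_def)
      from bchoice[OF this] obtain \<kappa> where \<kappa>: "\<forall>P\<in>\<gamma>. P \<subseteq> W (\<kappa> P)" ..
      \<comment> \<open>Each \<open>P\<close> lies in one \<open>W k\<close>, so cutting it with the
        stars that make up this \<open>W k\<close> loses no point.\<close>
      let ?\<gamma>' = "(\<lambda>(P, T). P \<inter> T) ` (SIGMA P:\<gamma>. S (\<kappa> P))"
      have "\<Union>?\<gamma>' = \<Union>\<gamma>"
        using \<kappa> by (fastforce simp: W_def)
      moreover have "disjoint_refinement X \<eta> ?\<gamma>'"
        by (rule disjoint_refinement_Int_Sigma[OF \<gamma> Sdis])
      ultimately show ?thesis by blast
    qed
  qed (rule foW)
qed

section \<open>Finite-dimensional subsets\<close>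

text \<open>Conditions \<open>1 \<le> q i x\<close> and \<open>q i x \<le> - 1\<close> describe disjoint closed subsets of the two
  members \<open>{h i > 0}\<close> and \<open>{h i < 1}\<close> of a binary cover. So \<open>m\<close> binary covers of \<open>X\<close> always have
  disjoint shrinkings which jointly cover \<open>Y\<close>.\<close>

definition inessential :: "'a topology \<Rightarrow> nat \<Rightarrow> 'a set \<Rightarrow> bool" where
  "inessential X m Y \<longleftrightarrow>
     (\<forall>h::nat \<Rightarrow> 'a \<Rightarrow> real. (\<forall>i<m. continuous_map X euclideanreal (h i)) \<longrightarrow>
       (\<exists>q. (\<forall>i<m. continuous_map X euclideanreal (q i)) \<and>
            (\<forall>i<m. \<forall>x\<in>topspace X.
               (1 \<le> q i x \<longrightarrow> 0 < h i x) \<and> (q i x \<le> - 1 \<longrightarrow> h i x < 1)) \<and>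
            (\<forall>x\<in>Y. \<exists>i<m. 1 \<le> \<bar>q i x\<bar>)))"

lemma inessential_finite:
  fixes h :: "'i \<Rightarrow> 'a \<Rightarrow> real"
  assumes "inessential X m Y" and A: "finite A" "card A = m"
    and h: "\<And>a. a \<in> A \<Longrightarrow> continuous_map X euclideanreal (h a)"
  shows "\<exists>q. (\<forall>a\<in>A. continuous_map X euclideanreal (q a)) \<and>
    (\<forall>a\<in>A. \<forall>x\<in>topspace X. (1 \<le> q a x \<longrightarrow> 0 < h a x) \<and> (q a x \<le> - 1 \<longrightarrow> h a x < 1)) \<and>
    (\<forall>x\<in>Y. \<exists>a\<in>A. 1 \<le> \<bar>q a x\<bar>)"
proof -
  obtain e where e: "bij_betw e A {0..<m}"
    using ex_bij_betw_finite_nat[OF A(1)] A(2) by blast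
  define f where "f = inv_into A e"
  have f: "f i \<in> A" if "i < m" for i
    using bij_betw_inv_into[OF e] that by (auto simp: f_def bij_betw_def)
  have fe: "f (e a) = a" "e a < m" if "a \<in> A" for a
    using e that by (auto simp: f_def bij_betw_def)
  have "\<forall>i<m. continuous_map X euclideanreal (h (f i))"
    using h f by blast
  then obtain q where q: "\<forall>i<m. continuous_map X euclideanreal (q i)"
    "\<forall>i<m. \<forall>x\<in>topspace X. (1 \<le> q i x \<longrightarrow> 0 < h (f i) x) \<and> (q i x \<le> - 1 \<longrightarrow> h (f i) x < 1)"
    "\<forall>x\<in>Y. \<exists>i<m. 1 \<le> \<bar>q i x\<bar>"
    using assms(1)[unfolded inessential_def, rule_format, of "\<lambda>i. h (f i)"] by blast
  have ef: "e (f i) = i" if "i < m" for i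
    using bij_betw_inv_into_right[OF e, of i] that by (simp add: f_def)
  show ?thesis
  proof (intro exI[of _ "\<lambda>a. q (e a)"] conjI ballI)
    show "\<exists>a\<in>A. 1 \<le> \<bar>q (e a) x\<bar>" if "x \<in> Y" for x
    proof -
      obtain i where "i < m" "1 \<le> \<bar>q i x\<bar>" using q(3) \<open>x \<in> Y\<close> by blast
      then show ?thesis using f ef by (intro bexI[of _ "f i"]) auto
    qed
    fix a assume a: "a \<in> A"
    show "continuous_map X euclideanreal (q (e a))"
      using q(1) fe(2)[OF a] by blast
    fix x assume "x \<in> topspace X"
    then have "(1 \<le> q (e a) x \<longrightarrow> 0 < h (f (e a)) x) \<and> (q (e a) x \<le> - 1 \<longrightarrow> h (f (e a)) x < 1)"
      using q(2) fe(2)[OF a] by blast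
    then show "1 \<le> q (e a) x \<longrightarrow> 0 < h a x" "q (e a) x \<le> - 1 \<longrightarrow> h a x < 1"
      by (simp_all add: fe(1)[OF a])
  qed
qed

section \<open>Lowering the order of a finite cover on a finite-dimensional subset\<close>

text \<open>A finite cozero cover \<open>{w k > 0}\<close>, \<open>k < N\<close>, given by its
  witnesses. Shrinking the cover means passing to weights with smaller positivity sets; the index
  set stays fixed although members may become empty.\<close>

definition cover_weights :: "'a topology \<Rightarrow> nat \<Rightarrow> (nat \<Rightarrow> 'a \<Rightarrow> real) \<Rightarrow> bool" where
  "cover_weights X N w \<longleftrightarrow>
     (\<forall>k<N. continuous_map X euclideanreal (w k)) \<and> (\<forall>k x. 0 \<le> w k x) \<and>
     (\<forall>x\<in>topspace X. \<exists>k<N. 0 < w k x)"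

text \<open>At each point of \<open>Y\<close> some \<open>q a\<close> with
  \<open>a \<in> \<sigma>\<close> has absolute value at least 1. The weight \<open>w a\<close> is
  damped to vanish where \<open>q a \<le> - 1\<close>, and every weight outside
  \<open>\<sigma>\<close> to vanish where some \<open>q a \<ge> 1\<close>. Either way the
  coincidence of \<open>\<sigma>\<close> with a further index is destroyed at that point. The
  constraints tying \<open>q\<close> to \<open>h\<close> ensure that the damped weights still
  cover.\<close>

lemma cover_weights_shrink_step:
  assumes w: "cover_weights X N w" and Y: "inessential X m Y" "Y \<subseteq> topspace X"
    and \<sigma>: "\<sigma> \<subseteq> {..<N}" "card \<sigma> = m"
  shows "\<exists>w'. cover_weights X N w' \<and> (\<forall>k x. 0 < w' k x \<longrightarrow> 0 < w k x) \<and>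
    (\<forall>x\<in>Y. \<forall>j<N. j \<notin> \<sigma> \<longrightarrow> (\<exists>k\<in>insert j \<sigma>. \<not> 0 < w' k x))"
proof -
  have cont: "\<And>k. k < N \<Longrightarrow> continuous_map X euclideanreal (w k)" and nonneg: "\<And>k x. 0 \<le> w k x"
    and cov: "\<And>x. x \<in> topspace X \<Longrightarrow> \<exists>k<N. 0 < w k x"
    using w by (auto simp: cover_weights_def)
  define T where "T = (\<lambda>x. \<Sum>k<N. w k x)"
  have T: "continuous_map X euclideanreal T"
    unfolding T_def using cont by (intro continuous_map_sum) auto
  have Tpos: "0 < T x" if "x \<in> topspace X" for x
  proof -
    obtain k where "k < N" "0 < w k x" using cov \<open>x \<in> topspace X\<close> by blast
    then show ?thesis unfolding T_def using nonneg by (intro sum_pos2[of _ k]) auto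
  qed
  \<comment> \<open>Some weight is at least the average, so the closed sets \<open>{h k \<ge> 1}\<close> cover \<open>X\<close>.\<close>
  define h where "h = (\<lambda>k x. real N * w k x / T x)"
  have conth: "continuous_map X euclideanreal (h k)" if "k < N" for k
    unfolding h_def using cont[OF that] T Tpos
    by (intro continuous_map_real_divide continuous_map_real_mult) force+
  have hpos: "0 < w k x" if "0 < h k x" for k x
    using that nonneg[of k x] by (cases "w k x = 0") (auto simp: h_def)
  have hge: "\<exists>k<N. 1 \<le> h k x" if x: "x \<in> topspace X" for x
  proof (rule ccontr)
    assume "\<not> (\<exists>k<N. 1 \<le> h k x)"
    then have lt: "real N * w k x < T x" if "k < N" for k
      using that Tpos[OF x] by (force simp: h_def field_simps)
    have "0 < N" using cov[OF x] by auto
    then have "(\<Sum>k<N. real N * w k x) < (\<Sum>k<N. T x)"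
      using lt by (intro sum_strict_mono) auto
    then show False by (simp add: T_def sum_distrib_left)
  qed
  have fin: "finite \<sigma>" using \<sigma>(1) finite_subset by blast
  have "\<exists>q. (\<forall>a\<in>\<sigma>. continuous_map X euclideanreal (q a)) \<and>
    (\<forall>a\<in>\<sigma>. \<forall>x\<in>topspace X. (1 \<le> q a x \<longrightarrow> 0 < h a x) \<and> (q a x \<le> - 1 \<longrightarrow> h a x < 1)) \<and>
    (\<forall>x\<in>Y. \<exists>a\<in>\<sigma>. 1 \<le> \<bar>q a x\<bar>)"
    by (rule inessential_finite[OF Y(1) fin \<sigma>(2)]) (use conth \<sigma>(1) in auto)
  then obtain q where q: "\<forall>a\<in>\<sigma>. continuous_map X euclideanreal (q a)"
    "\<forall>a\<in>\<sigma>. \<forall>x\<in>topspace X. (1 \<le> q a x \<longrightarrow> 0 < h a x) \<and> (q a x \<le> - 1 \<longrightarrow> h a x < 1)"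
    "\<forall>x\<in>Y. \<exists>a\<in>\<sigma>. 1 \<le> \<bar>q a x\<bar>"
    by blast
  define w' where "w' k x = w k x *
    (if k \<in> \<sigma> then max 0 (1 + q k x) else \<Prod>a\<in>\<sigma>. max 0 (1 - q a x))" for k x
  have w'in: "w' k = (\<lambda>x. w k x * max 0 (1 + q k x))" if "k \<in> \<sigma>" for k
    using that by (auto simp: w'_def)
  have w'out: "w' k = (\<lambda>x. w k x * (\<Prod>a\<in>\<sigma>. max 0 (1 - q a x)))" if "k \<notin> \<sigma>" for k
    using that by (auto simp: w'_def)
  have prod_pos: "0 < (\<Prod>a\<in>\<sigma>. max 0 (1 - q a x))" if "\<forall>a\<in>\<sigma>. q a x < 1" for x
    by (rule prod_pos) (use that in auto)
  have prod_zero: "(\<Prod>a\<in>\<sigma>. max 0 (1 - q a x)) = 0" if "a \<in> \<sigma>" "1 \<le> q a x" for a x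
    by (rule prod_zero[OF fin]) (use that in force)
  have nonneg': "0 \<le> w' k x" for k x
    unfolding w'_def using nonneg by (intro mult_nonneg_nonneg) (auto intro!: prod_nonneg)
  have "cover_weights X N w'"
    unfolding cover_weights_def
  proof (intro conjI allI impI ballI nonneg')
    show "continuous_map X euclideanreal (w' k)" if "k < N" for k
    proof (cases "k \<in> \<sigma>")
      case True
      then show ?thesis
        unfolding w'in[OF True] using cont[OF that] q(1)
        by (intro continuous_map_real_mult continuous_map_real_max continuous_map_add) auto
    next
      case False
      then show ?thesis
        unfolding w'out[OF False] using cont[OF that] q(1) fin
        by (intro continuous_map_real_mult continuous_map_prod continuous_map_real_max
            continuous_map_diff) auto
    qed
    fix x assume x: "x \<in> topspace X"
    obtain k where k: "k < N" "1 \<le> h k x" using hge[OF x] by blast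
    have wk: "0 < w k x" using hpos k(2) by force
    show "\<exists>k<N. 0 < w' k x"
    proof (cases "k \<in> \<sigma>")
      case True
      \<comment> \<open>A value \<open>q k x \<le> - 1\<close> would force \<open>h k x < 1\<close>,
        so the damping factor of the selected weight is positive.\<close>
      then have "- 1 < q k x" using q(2) x k(2) by force
      then have "0 < w' k x" unfolding w'in[OF True] using wk by simp
      then show ?thesis using k by blast
    next
      case False
      show ?thesis
      proof (cases "\<forall>a\<in>\<sigma>. q a x < 1")
        case True
        then have "0 < w' k x" unfolding w'out[OF False] using wk prod_pos by simp
        then show ?thesis using k by blast
      next
        case False
        then obtain a where a: "a \<in> \<sigma>" "1 \<le> q a x" by force
        \<comment> \<open>All weights outside \<open>\<sigma>\<close> vanish here, but
          \<open>q a x \<ge> 1\<close> forces \<open>h a x > 0\<close>, so \<open>w a\<close> takes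
          over.\<close>
        then have "0 < w a x" using q(2) x hpos by blast
        then have "0 < w' a x" unfolding w'in[OF a(1)] using a(2) by simp
        then show ?thesis using a \<sigma>(1) by blast
      qed
    qed
  qed
  moreover have "0 < w k x" if "0 < w' k x" for k x
    using that nonneg[of k x] by (cases "w k x = 0") (auto simp: w'_def)
  moreover have "\<exists>k\<in>insert j \<sigma>. \<not> 0 < w' k x" if "x \<in> Y" "j \<notin> \<sigma>" for x j
  proof -
    obtain a where a: "a \<in> \<sigma>" "1 \<le> \<bar>q a x\<bar>" using q(3) \<open>x \<in> Y\<close> by blast
    show ?thesis
    proof (cases "1 \<le> q a x")
      case True
      then show ?thesis using w'out[OF \<open>j \<notin> \<sigma>\<close>] prod_zero[OF a(1)] by auto
    next
      case False
      then have "q a x \<le> - 1" using a(2) by linarith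
      then show ?thesis using w'in[OF a(1)] a(1) by (intro bexI[of _ a]) auto
    qed
  qed
  ultimately show ?thesis by blast
qed

text \<open>In the spirit of the Eilenberg-Otto theorem, with \<open>m\<close> in the role of
  dimension plus one. More than \<open>m\<close> positive weights would include an
  \<open>m\<close>-element \<open>\<sigma>\<close> and an index \<open>j\<close> outside it, so it
  is enough to treat the finitely many \<open>\<sigma>\<close> one after another; a later shrinking
  never revives a weight.\<close>

lemma cover_weights_order_reduction:
  assumes w: "cover_weights X N w" and Y: "inessential X m Y" "Y \<subseteq> topspace X"
  shows "\<exists>w'. cover_weights X N w' \<and> (\<forall>k x. 0 < w' k x \<longrightarrow> 0 < w k x) \<and>
    (\<forall>x\<in>Y. card {k. k < N \<and> 0 < w' k x} \<le> m)"
proof -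
  have step: "\<exists>w'. cover_weights X N w' \<and> (\<forall>k x. 0 < w' k x \<longrightarrow> 0 < w k x) \<and>
      (\<forall>\<sigma>\<in>S. \<forall>x\<in>Y. \<forall>j<N. j \<notin> \<sigma> \<longrightarrow> (\<exists>k\<in>insert j \<sigma>. \<not> 0 < w' k x))"
    if "finite S" "S \<subseteq> {\<sigma>. \<sigma> \<subseteq> {..<N} \<and> card \<sigma> = m}" for S
    using that
  proof (induction S)
    case empty
    show ?case using w by (intro exI[of _ w]) auto
  next
    case (insert \<sigma> S)
    then obtain v where v: "cover_weights X N v" "\<forall>k x. 0 < v k x \<longrightarrow> 0 < w k x"
      "\<forall>\<sigma>\<in>S. \<forall>x\<in>Y. \<forall>j<N. j \<notin> \<sigma> \<longrightarrow> (\<exists>k\<in>insert j \<sigma>. \<not> 0 < v k x)"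
      by auto
    obtain w' where w': "cover_weights X N w'" "\<forall>k x. 0 < w' k x \<longrightarrow> 0 < v k x"
      "\<forall>x\<in>Y. \<forall>j<N. j \<notin> \<sigma> \<longrightarrow> (\<exists>k\<in>insert j \<sigma>. \<not> 0 < w' k x)"
      using cover_weights_shrink_step[OF v(1) Y, of \<sigma>] insert.prems by auto
    have "\<exists>k\<in>insert j \<tau>. \<not> 0 < w' k x" if \<tau>: "\<tau> \<in> insert \<sigma> S" and "x \<in> Y" "j < N" "j \<notin> \<tau>" for \<tau> x j
    proof (cases "\<tau> = \<sigma>")
      case True
      then show ?thesis using w'(3) that by blast
    next
      case False
      then have "\<exists>k\<in>insert j \<tau>. \<not> 0 < v k x" using v(3) that by blast
      then show ?thesis using w'(2) by blast
    qed
    then show ?case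
      using w' v(2) by (intro exI[of _ w'] conjI) blast+
  qed
  have "finite {\<sigma>. \<sigma> \<subseteq> {..<N} \<and> card \<sigma> = m}"
    by (rule finite_subset[of _ "Pow {..<N}"]) auto
  then obtain w' where w': "cover_weights X N w'" "\<forall>k x. 0 < w' k x \<longrightarrow> 0 < w k x"
    "\<forall>\<sigma>\<in>{\<sigma>. \<sigma> \<subseteq> {..<N} \<and> card \<sigma> = m}. \<forall>x\<in>Y. \<forall>j<N. j \<notin> \<sigma> \<longrightarrow>
      (\<exists>k\<in>insert j \<sigma>. \<not> 0 < w' k x)"
    using step[OF _ subset_refl] by blast
  have "card {k. k < N \<and> 0 < w' k x} \<le> m" if "x \<in> Y" for x
  proof (rule ccontr)
    define T where "T = {k. k < N \<and> 0 < w' k x}"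
    assume "\<not> card {k. k < N \<and> 0 < w' k x} \<le> m"
    then have "m < card T" by (simp add: T_def)
    then obtain \<sigma> where \<sigma>: "\<sigma> \<subseteq> T" "card \<sigma> = m" "finite \<sigma>"
      using obtain_subset_with_card_n[of m T] by (metis less_imp_le)
    then have "\<sigma> \<noteq> T" using \<open>m < card T\<close> by auto
    then obtain j where j: "j \<in> T" "j \<notin> \<sigma>" using \<sigma>(1) by blast
    have "\<sigma> \<subseteq> {..<N}" "j < N" using \<sigma>(1) j by (auto simp: T_def)
    then obtain k where "k \<in> insert j \<sigma>" "\<not> 0 < w' k x"
      using w'(3) \<sigma>(2) j(2) \<open>x \<in> Y\<close> by blast
    then show False using \<sigma>(1) j(1) by (auto simp: T_def)
  qed
  then show ?thesis using w' by blast
qed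

text \<open>At a point of \<open>Y\<close> between 1 and \<open>m\<close> of the reduced weights are
  positive, so stars of cardinality \<open>1, ..., m\<close> suffice there, and stars of equal
  cardinality are disjoint.\<close>

lemma inessential_finite_cover_refinement:
  assumes w: "cover_weights X N w" and Y: "inessential X m Y" "Y \<subseteq> topspace X"
  shows "\<exists>\<delta>. (\<forall>i<m. disjoint_refinement X ((\<lambda>k. {x \<in> topspace X. 0 < w k x}) ` {..<N}) (\<delta> i)) \<and>
    Y \<subseteq> \<Union>(\<Union>i<m. \<delta> i)"
proof -
  obtain w' where w': "cover_weights X N w'" "\<forall>k x. 0 < w' k x \<longrightarrow> 0 < w k x"
    "\<forall>x\<in>Y. card {k. k < N \<and> 0 < w' k x} \<le> m"
    using cover_weights_order_reduction[OF w Y] by blast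
  have cont: "continuous_map X euclideanreal (w' k)" if "k \<in> {..<N}" for k
    using w'(1) that by (auto simp: cover_weights_def)
  have nonneg: "0 \<le> w' k x" for k x
    using w'(1) by (auto simp: cover_weights_def)
  have lf: "\<exists>U. openin X U \<and> x \<in> U \<and> finite {k \<in> {..<N}. \<exists>y\<in>U. w' k y \<noteq> 0}"
    if "x \<in> topspace X" for x
    using that by (intro exI[of _ "topspace X"]) auto
  let ?V = "star X {..<N} w'"
  define \<delta> where "\<delta> i = ?V ` {\<sigma>. \<sigma> \<subseteq> {..<N} \<and> card \<sigma> = Suc i}" for i
  have fin: "finite \<sigma>" if "\<sigma> \<subseteq> {..<N}" for \<sigma>
    using that finite_subset by blast
  have "disjoint_refinement X ((\<lambda>k. {x \<in> topspace X. 0 < w k x}) ` {..<N}) (\<delta> i)" for i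
    unfolding disjoint_refinement_def
  proof (intro conjI ballI)
    show "functionally_open X P" if "P \<in> \<delta> i" for P
      using that functionally_open_star[OF cont nonneg lf fin] by (auto simp: \<delta>_def)
    show "pairwise disjnt (\<delta> i)"
    proof (intro pairwiseI)
      fix P Q assume "P \<in> \<delta> i" "Q \<in> \<delta> i" "P \<noteq> Q"
      then obtain \<sigma> \<tau> where \<sigma>: "\<sigma> \<subseteq> {..<N}" "card \<sigma> = Suc i" "P = ?V \<sigma>"
        and \<tau>: "\<tau> \<subseteq> {..<N}" "card \<tau> = Suc i" "Q = ?V \<tau>"
        by (auto simp: \<delta>_def)
      have "disjnt (?V \<sigma>) (?V \<tau>)"
        by (rule disjnt_star[OF cont nonneg lf fin[OF \<sigma>(1)] \<sigma>(1) fin[OF \<tau>(1)] \<tau>(1)])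
          (use \<sigma> \<tau> \<open>P \<noteq> Q\<close> in auto)
      then show "disjnt P Q" using \<sigma> \<tau> by simp
    qed
    have "finite {\<sigma>. \<sigma> \<subseteq> {..<N} \<and> card \<sigma> = Suc i}"
      by (rule finite_subset[of _ "Pow {..<N}"]) auto
    then show "locally_finite_in X (\<delta> i)"
      by (intro finite_imp_locally_finite_in) (auto simp: \<delta>_def star_def)
    show "refines (\<delta> i) ((\<lambda>k. {x \<in> topspace X. 0 < w k x}) ` {..<N})"
      unfolding refines_def
    proof
      fix P assume "P \<in> \<delta> i"
      then obtain \<sigma> where \<sigma>: "\<sigma> \<subseteq> {..<N}" "card \<sigma> = Suc i" "P = ?V \<sigma>"
        by (auto simp: \<delta>_def)
      then have "\<sigma> \<noteq> {}" by auto
      then obtain k where k: "k \<in> \<sigma>" by blast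
      have "0 < w k x" if "x \<in> ?V \<sigma>" for x
        using star_positive[OF cont nonneg lf fin[OF \<sigma>(1)] \<sigma>(1) k that] w'(2) by blast
      then have "P \<subseteq> {x \<in> topspace X. 0 < w k x}"
        using \<sigma>(3) by (auto simp: star_def)
      then show "\<exists>U\<in>(\<lambda>k. {x \<in> topspace X. 0 < w k x}) ` {..<N}. P \<subseteq> U"
        using k \<sigma>(1) by blast
    qed
  qed
  moreover have "Y \<subseteq> \<Union>(\<Union>i<m. \<delta> i)"
  proof
    fix x assume x: "x \<in> Y"
    then have xX: "x \<in> topspace X" using Y(2) by blast
    define \<sigma> where "\<sigma> = {k \<in> {..<N}. 0 < w' k x}"
    have "x \<in> ?V \<sigma>"
      unfolding \<sigma>_def by (rule in_star_positive[OF cont nonneg lf xX])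
    have "card \<sigma> \<le> m" using w'(3) x by (auto simp: \<sigma>_def)
    have "\<sigma> \<noteq> {}" using w'(1) xX by (auto simp: \<sigma>_def cover_weights_def)
    moreover have "finite \<sigma>" by (simp add: \<sigma>_def)
    ultimately obtain i where i: "card \<sigma> = Suc i"
      by (metis card_0_eq not0_implies_Suc)
    have "?V \<sigma> \<in> \<delta> i" using i by (auto simp: \<delta>_def \<sigma>_def)
    moreover have "i < m" using i \<open>card \<sigma> \<le> m\<close> by simp
    ultimately show "x \<in> \<Union>(\<Union>i<m. \<delta> i)" using \<open>x \<in> ?V \<sigma>\<close> by blast
  qed
  ultimately show ?thesis by blast
qed

text \<open>Over the open slab \<open>{j - 3 < g < j - 1}\<close> the countable cover \<open>W\<close> can be replaced by finitely
  many of its members. Slabs whose indices have equal parity are disjoint, so the finite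
  refinements over them can be merged.\<close>

lemma inessential_refinement:
  assumes Y: "inessential X m Y" "Y \<subseteq> topspace X" and \<eta>: "locally_finite_cover X \<eta>"
  shows "\<exists>\<delta>. (\<forall>i<2 * m. disjoint_refinement X \<eta> (\<delta> i)) \<and> Y \<subseteq> \<Union>(\<Union>i<2 * m. \<delta> i)"
proof -
  obtain W :: "nat \<Rightarrow> 'a set" and g :: "'a \<Rightarrow> real" where
    foW: "\<And>k. functionally_open X (W k)" and g: "continuous_map X euclideanreal g"
    and gnonneg: "\<And>x. x \<in> topspace X \<Longrightarrow> 0 \<le> g x"
    and gW: "\<And>x j. \<lbrakk>x \<in> topspace X; g x < real j\<rbrakk> \<Longrightarrow> \<exists>k<j. x \<in> W k"
    and split: "\<And>\<gamma>. disjoint_refinement X (range W) \<gamma> \<Longrightarrow>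
      \<exists>\<gamma>'. disjoint_refinement X \<eta> \<gamma>' \<and> \<Union>\<gamma>' = \<Union>\<gamma>"
    using countable_reduction[OF \<eta>] by blast
  obtain w where
    "(\<forall>k\<in>UNIV. continuous_map X euclideanreal (w k)) \<and> (\<forall>k x. 0 \<le> w k x) \<and>
      (\<forall>k\<in>UNIV. \<forall>x. x \<in> W k \<longleftrightarrow> x \<in> topspace X \<and> 0 < w k x)"
    using functionally_open_family[of UNIV X W, OF foW] ..
  then have w: "\<And>k. continuous_map X euclideanreal (w k)" "\<And>k x. 0 \<le> w k x"
      "\<And>k x. x \<in> W k \<longleftrightarrow> x \<in> topspace X \<and> 0 < w k x"
    by blast+
  \<comment> \<open>The extra member \<open>{g > j - 1}\<close> completes
    \<open>W 0, ..., W (j - 1)\<close> to a finite cover: where \<open>g < j\<close> one of these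
    applies, and elsewhere \<open>g > j - 1\<close>.\<close>
  define v where "v j k = (if k < j then w k else (\<lambda>x. max 0 (g x - (real j - 1))))" for j k
  have v: "cover_weights X (Suc j) (v j)" for j
    unfolding cover_weights_def
  proof (intro conjI allI impI ballI)
    show "continuous_map X euclideanreal (v j k)" for k
      unfolding v_def using w(1) g
      by (auto intro!: continuous_map_real_max continuous_map_diff)
    show "0 \<le> v j k x" for k x
      using w(2) by (simp add: v_def)
    fix x assume x: "x \<in> topspace X"
    show "\<exists>k<Suc j. 0 < v j k x"
    proof (cases "g x < real j")
      case True
      then obtain k where "k < j" "x \<in> W k" using gW x by blast
      then show ?thesis using w(3) by (intro exI[of _ k]) (auto simp: v_def)
    next
      case False
      then show ?thesis by (intro exI[of _ j]) (auto simp: v_def)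
    qed
  qed
  have "\<forall>j. \<exists>\<delta>. (\<forall>i<m. disjoint_refinement X ((\<lambda>k. {x \<in> topspace X. 0 < v j k x}) ` {..<Suc j}) (\<delta> i))
      \<and> Y \<subseteq> \<Union>(\<Union>i<m. \<delta> i)"
    using inessential_finite_cover_refinement[OF v Y] by blast
  from choice[OF this] obtain fam where fam:
    "\<forall>j. (\<forall>i<m. disjoint_refinement X ((\<lambda>k. {x \<in> topspace X. 0 < v j k x}) ` {..<Suc j}) (fam j i))
      \<and> Y \<subseteq> \<Union>(\<Union>i<m. fam j i)" ..
  \<comment> \<open>\<open>A j\<close> stays below \<open>g = j - 1\<close>, so it misses the extra
    member of the \<open>j\<close>-th cover. Half-width 1 lets consecutive slabs overlap, while
    slabs whose centres are at least 2 apart are disjoint.\<close>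
  define A where "A j = {x \<in> topspace X. 0 < 1 - \<bar>g x - (real j - 2)\<bar>}" for j :: nat
  have foA: "functionally_open X (A j)" for j
    unfolding A_def using g
    by (intro functionally_open_positive continuous_map_diff continuous_map_real_abs) auto
  define slabs where "slabs p = A ` {j. j mod 2 = p}" for p :: nat
  have slabs: "disjoint_refinement X (slabs p) (slabs p)" for p
    unfolding disjoint_refinement_def
  proof (intro conjI ballI)
    show "functionally_open X P" if "P \<in> slabs p" for P
      using that foA by (auto simp: slabs_def)
    show "refines (slabs p) (slabs p)"
      by (auto simp: refines_def)
    show "pairwise disjnt (slabs p)"
    proof (intro pairwiseI)
      fix P Q assume "P \<in> slabs p" "Q \<in> slabs p" "P \<noteq> Q"
      then obtain j k where jk: "j mod 2 = p" "k mod 2 = p" "P = A j" "Q = A k" "j \<noteq> k"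
        by (auto simp: slabs_def)
      then have "j + 2 \<le> k \<or> k + 2 \<le> j" by presburger
      then have "2 \<le> \<bar>real j - real k\<bar>" by linarith
      then show "disjnt P Q"
        unfolding jk disjnt_def A_def by auto
    qed
    show "locally_finite_in X (slabs p)"
      unfolding locally_finite_in_def
    proof (intro conjI ballI)
      show "\<Union>(slabs p) \<subseteq> topspace X" by (auto simp: slabs_def A_def)
      fix x assume x: "x \<in> topspace X"
      define N where "N = {y \<in> topspace X. g y \<in> {..<g x + 1}}"
      have "openin X N"
        unfolding N_def using g by (rule openin_continuous_map_preimage) simp
      moreover have "x \<in> N" using x by (simp add: N_def)
      moreover have "{P \<in> slabs p. P \<inter> N \<noteq> {}} \<subseteq> A ` {..nat \<lceil>g x + 4\<rceil>}"
      proof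
        fix P assume "P \<in> {P \<in> slabs p. P \<inter> N \<noteq> {}}"
        then obtain j y where j: "P = A j" "y \<in> A j" "y \<in> N"
          by (auto simp: slabs_def)
        then have "real j \<le> g x + 4" by (auto simp: A_def N_def)
        then have "j \<le> nat \<lceil>g x + 4\<rceil>" by linarith
        then show "P \<in> A ` {..nat \<lceil>g x + 4\<rceil>}" using j by blast
      qed
      ultimately show "\<exists>N. openin X N \<and> x \<in> N \<and> finite {P \<in> slabs p. P \<inter> N \<noteq> {}}"
        by (meson finite_atMost finite_imageI finite_subset)
    qed
  qed
  have index: "\<forall>p. \<forall>P\<in>slabs p. \<exists>j. P = A j"
    by (auto simp: slabs_def)
  \<comment> \<open>Different \<open>j\<close> may give the same set, for instance the empty one, so
    one index is chosen for each slab.\<close>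
  define \<iota> where "\<iota> P = (SOME j. P = A j)" for P
  have \<iota>: "A (\<iota> P) = P" if "P \<in> slabs p" for P p
    unfolding \<iota>_def using someI_ex[of "\<lambda>j. P = A j"] index that by metis
  define S where "S i P = (\<lambda>V. V \<inter> P) ` fam (\<iota> P) i" for i P
  have S: "disjoint_refinement X (range W) (S i P)" if P: "P \<in> slabs p" and i: "i < m" for i p P
  proof -
    let ?j = "\<iota> P"
    have d: "disjoint_refinement X ((\<lambda>k. {x \<in> topspace X. 0 < v ?j k x}) ` {..<Suc ?j}) (fam ?j i)"
      using fam i by blast
    have foP: "functionally_open X P" using foA \<iota>[OF P] by metis
    show ?thesis
      unfolding disjoint_refinement_def
    proof (intro conjI ballI)
      show "functionally_open X Q" if "Q \<in> S i P" for Q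
        using that d foP by (auto simp: S_def disjoint_refinement_def intro!: functionally_open_Int)
      show "pairwise disjnt (S i P)"
      proof (intro pairwiseI)
        fix Q R assume "Q \<in> S i P" "R \<in> S i P" "Q \<noteq> R"
        then obtain Q' R' where *: "Q' \<in> fam ?j i" "R' \<in> fam ?j i" "Q = Q' \<inter> P" "R = R' \<inter> P" "Q' \<noteq> R'"
          by (auto simp: S_def)
        then have "disjnt Q' R'" using d by (auto simp: disjoint_refinement_def pairwise_def)
        then show "disjnt Q R" using * by (auto simp: disjnt_def)
      qed
      show "locally_finite_in X (S i P)"
        unfolding S_def using d
        by (intro locally_finite_in_refinement) (auto simp: disjoint_refinement_def)
      show "refines (S i P) (range W)"
        unfolding refines_def
      proof
        fix Q assume "Q \<in> S i P"
        then obtain V where V: "V \<in> fam ?j i" "Q = V \<inter> P" by (auto simp: S_def)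
        obtain k where k: "k < Suc ?j" "V \<subseteq> {x \<in> topspace X. 0 < v ?j k x}"
          using d V(1) by (auto simp: disjoint_refinement_def refines_def)
        have "Q \<subseteq> W k"
        proof
          fix x assume x: "x \<in> Q"
          then have "0 < v ?j k x" and xX: "x \<in> topspace X" using V k by auto
          moreover have "x \<in> A ?j" using x V(2) \<iota>[OF P] by simp
          ultimately have "k < ?j" by (auto simp: A_def v_def split: if_splits)
          then show "x \<in> W k" using \<open>0 < v ?j k x\<close> xX w(3) by (simp add: v_def)
        qed
        then show "\<exists>U\<in>range W. Q \<subseteq> U" by blast
      qed
    qed
  qed
  \<comment> \<open>The number \<open>n = 2 * i + p\<close> encodes the family \<open>i\<close> and
    the parity \<open>p\<close>, whence the factor 2 in the bound.\<close>
  define \<gamma> where "\<gamma> n = (\<lambda>(P, T). P \<inter> T) ` (SIGMA P:slabs (n mod 2). S (n div 2) P)" for n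
  have "\<exists>\<gamma>'. disjoint_refinement X \<eta> \<gamma>' \<and> \<Union>\<gamma>' = \<Union>(\<gamma> n)" if "n < 2 * m" for n
  proof (rule split[of "\<gamma> n"])
    show "disjoint_refinement X (range W) (\<gamma> n)"
      unfolding \<gamma>_def by (rule disjoint_refinement_Int_Sigma[OF slabs S]) (use that in auto)
  qed
  then have "\<forall>n\<in>{..<2 * m}. \<exists>\<gamma>'. disjoint_refinement X \<eta> \<gamma>' \<and> \<Union>\<gamma>' = \<Union>(\<gamma> n)"
    by (intro ballI) simp
  from bchoice[OF this] obtain \<delta> where
    "\<forall>n\<in>{..<2 * m}. disjoint_refinement X \<eta> (\<delta> n) \<and> \<Union>(\<delta> n) = \<Union>(\<gamma> n)" ..
  then have \<delta>: "disjoint_refinement X \<eta> (\<delta> n)" "\<Union>(\<delta> n) = \<Union>(\<gamma> n)" if "n < 2 * m" for n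
    using that by simp_all
  have "Y \<subseteq> \<Union>(\<Union>i<2 * m. \<delta> i)"
  proof
    fix x assume x: "x \<in> Y"
    then have xX: "x \<in> topspace X" using Y(2) by blast
    define j where "j = nat \<lfloor>g x\<rfloor> + 2"
    have "x \<in> A j"
      using gnonneg[OF xX] xX by (simp add: A_def j_def) linarith
    define P where "P = A j"
    define p where "p = j mod 2"
    have P: "P \<in> slabs p" by (auto simp: P_def slabs_def p_def)
    obtain i V where i: "i < m" "V \<in> fam (\<iota> P) i" "x \<in> V"
      using fam x by blast
    define n where "n = 2 * i + p"
    have n: "n mod 2 = p" "n div 2 = i" "n < 2 * m"
      using i(1) by (auto simp: n_def p_def)
    have "V \<inter> P \<in> S (n div 2) P" using i(2) n by (auto simp: S_def)
    then have "P \<inter> (V \<inter> P) \<in> \<gamma> n"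
      unfolding \<gamma>_def using P n(1) by force
    then have "x \<in> \<Union>(\<gamma> n)" using i(3) \<open>x \<in> A j\<close> unfolding P_def by blast
    then have "x \<in> \<Union>(\<delta> n)" using \<delta>(2)[OF n(3)] by simp
    then show "x \<in> \<Union>(\<Union>i<2 * m. \<delta> i)" using n(3) by blast
  qed
  then show ?thesis
    using \<delta>(1) by (intro exI[of _ \<delta>] conjI allI impI)
qed

section \<open>Refinability with a bound that does not depend on the covers\<close>

text \<open>The bound \<open>d\<close> is quantified before the covers. It therefore serves any
  later stretch of a given sequence, and the bounds of two sets can be added.\<close>

definition finitely_refinable :: "'a topology \<Rightarrow> 'a set \<Rightarrow> bool" where
  "finitely_refinable X Y \<longleftrightarrow>
     (\<exists>d. \<forall>\<eta>::nat \<Rightarrow> 'a set set. (\<forall>i. locally_finite_cover X (\<eta> i)) \<longrightarrow>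
        (\<exists>\<delta>. (\<forall>i<d. disjoint_refinement X (\<eta> i) (\<delta> i)) \<and> Y \<subseteq> \<Union>(\<Union>i<d. \<delta> i)))"

text \<open>\<open>inessential_refinement\<close> handles a single cover, whereas
  \<open>finitely_refinable\<close> asks for a different cover at each index; a common refinement of
  finitely many covers reconciles the two.\<close>

lemma common_locally_finite_refinement:
  fixes \<eta> :: "nat \<Rightarrow> 'a set set"
  assumes "\<And>i. locally_finite_cover X (\<eta> i)"
  shows "\<exists>\<zeta>. locally_finite_cover X \<zeta> \<and> (\<forall>i<d. refines \<zeta> (\<eta> i))"
proof (induction d)
  case 0
  have "locally_finite_cover X {topspace X}"
    unfolding locally_finite_cover_def
    by (auto intro: finite_imp_locally_finite_in functionally_open_topspace)
  then show ?case by blast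
next
  case (Suc d)
  then obtain \<zeta> where \<zeta>: "locally_finite_cover X \<zeta>" "\<forall>i<d. refines \<zeta> (\<eta> i)"
    by blast
  let ?\<xi> = "(\<lambda>(V, T). V \<inter> T) ` (SIGMA V:\<zeta>. \<eta> d)"
  have "locally_finite_in X ?\<xi>"
    using \<zeta>(1) assms[of d]
    by (intro locally_finite_in_Int_Sigma) (auto simp: locally_finite_cover_def)
  moreover have "functionally_open X U" if "U \<in> ?\<xi>" for U
    using that \<zeta>(1) assms[of d]
    by (auto simp: locally_finite_cover_def intro!: functionally_open_Int)
  moreover have "\<Union>?\<xi> = \<Union>\<zeta> \<inter> \<Union>(\<eta> d)"
    by auto
  ultimately have "locally_finite_cover X ?\<xi>"
    using \<zeta>(1) assms[of d] by (auto simp: locally_finite_cover_def)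
  moreover have "refines ?\<xi> (\<eta> i)" if "i < Suc d" for i
  proof (cases "i = d")
    case True
    then show ?thesis by (auto simp: refines_def)
  next
    case False
    then have "refines \<zeta> (\<eta> i)" using \<zeta>(2) that by simp
    show ?thesis
      unfolding refines_def
    proof
      fix P assume "P \<in> ?\<xi>"
      then obtain V where V: "V \<in> \<zeta>" "P \<subseteq> V" by auto
      then obtain U where "U \<in> \<eta> i" "V \<subseteq> U"
        using \<open>refines \<zeta> (\<eta> i)\<close> by (auto simp: refines_def)
      then show "\<exists>U\<in>\<eta> i. P \<subseteq> U" using V(2) by blast
    qed
  qed
  ultimately show ?case by blast
qed

lemma disjoint_refinement_trans:
  assumes "disjoint_refinement X \<zeta> \<gamma>" "refines \<zeta> \<eta>"
  shows "disjoint_refinement X \<eta> \<gamma>"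
proof -
  have "refines \<gamma> \<eta>"
    unfolding refines_def
  proof
    fix V assume "V \<in> \<gamma>"
    then obtain U where "U \<in> \<zeta>" "V \<subseteq> U"
      using assms(1) by (auto simp: disjoint_refinement_def refines_def)
    moreover then obtain T where "T \<in> \<eta>" "U \<subseteq> T"
      using assms(2) by (auto simp: refines_def)
    ultimately show "\<exists>T\<in>\<eta>. V \<subseteq> T" by blast
  qed
  then show ?thesis using assms(1) by (simp add: disjoint_refinement_def)
qed

lemma inessential_imp_finitely_refinable:
  assumes "inessential X m Y" "Y \<subseteq> topspace X"
  shows "finitely_refinable X Y"
  unfolding finitely_refinable_def
proof (intro exI[of _ "2 * m"] allI impI)
  fix \<eta> :: "nat \<Rightarrow> 'a set set" assume "\<forall>i. locally_finite_cover X (\<eta> i)"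
  then obtain \<zeta> where \<zeta>: "locally_finite_cover X \<zeta>" "\<forall>i<2 * m. refines \<zeta> (\<eta> i)"
    using common_locally_finite_refinement[of X \<eta> "2 * m"] by blast
  then obtain \<delta> where "\<forall>i<2 * m. disjoint_refinement X \<zeta> (\<delta> i)" "Y \<subseteq> \<Union>(\<Union>i<2 * m. \<delta> i)"
    using inessential_refinement[OF assms \<zeta>(1)] by blast
  then show "\<exists>\<delta>. (\<forall>i<2 * m. disjoint_refinement X (\<eta> i) (\<delta> i)) \<and> Y \<subseteq> \<Union>(\<Union>i<2 * m. \<delta> i)"
    using \<zeta>(2) by (intro exI[of _ \<delta>]) (auto intro: disjoint_refinement_trans)
qed

lemma finitely_refinable_empty: "finitely_refinable X {}"
  unfolding finitely_refinable_def by (intro exI[of _ 0]) auto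

text \<open>The first \<open>d\<close> covers are spent on \<open>Y\<close> and the next
  \<open>e\<close> on \<open>Z\<close>.\<close>

lemma finitely_refinable_Un:
  assumes "finitely_refinable X Y" "finitely_refinable X Z"
  shows "finitely_refinable X (Y \<union> Z)"
proof -
  obtain d where d: "\<forall>\<eta>::nat \<Rightarrow> 'a set set. (\<forall>i. locally_finite_cover X (\<eta> i)) \<longrightarrow>
      (\<exists>\<delta>. (\<forall>i<d. disjoint_refinement X (\<eta> i) (\<delta> i)) \<and> Y \<subseteq> \<Union>(\<Union>i<d. \<delta> i))"
    using assms(1) unfolding finitely_refinable_def ..
  obtain e where e: "\<forall>\<eta>::nat \<Rightarrow> 'a set set. (\<forall>i. locally_finite_cover X (\<eta> i)) \<longrightarrow>
      (\<exists>\<delta>. (\<forall>i<e. disjoint_refinement X (\<eta> i) (\<delta> i)) \<and> Z \<subseteq> \<Union>(\<Union>i<e. \<delta> i))"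
    using assms(2) unfolding finitely_refinable_def ..
  show ?thesis
    unfolding finitely_refinable_def
  proof (intro exI[of _ "d + e"] allI impI)
    fix \<eta> :: "nat \<Rightarrow> 'a set set" assume \<eta>: "\<forall>i. locally_finite_cover X (\<eta> i)"
    obtain \<delta> where \<delta>: "\<forall>i<d. disjoint_refinement X (\<eta> i) (\<delta> i)" "Y \<subseteq> \<Union>(\<Union>i<d. \<delta> i)"
      using d[THEN spec, of \<eta>] \<eta> by auto
    obtain \<epsilon> where \<epsilon>: "\<forall>i<e. disjoint_refinement X (\<eta> (d + i)) (\<epsilon> i)" "Z \<subseteq> \<Union>(\<Union>i<e. \<epsilon> i)"
      using e[THEN spec, of "\<lambda>i. \<eta> (d + i)"] \<eta> by auto
    define \<theta> where "\<theta> i = (if i < d then \<delta> i else \<epsilon> (i - d))" for i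
    have "disjoint_refinement X (\<eta> i) (\<theta> i)" if "i < d + e" for i
      using \<delta>(1) \<epsilon>(1)[rule_format, of "i - d"] that by (auto simp: \<theta>_def)
    moreover have "Y \<subseteq> \<Union>(\<Union>i<d + e. \<theta> i)"
    proof
      fix x assume "x \<in> Y"
      then obtain i where "i < d" "x \<in> \<Union>(\<delta> i)" using \<delta>(2) by blast
      then have "i < d + e" "x \<in> \<Union>(\<theta> i)" by (auto simp: \<theta>_def)
      then show "x \<in> \<Union>(\<Union>i<d + e. \<theta> i)" by blast
    qed
    moreover have "Z \<subseteq> \<Union>(\<Union>i<d + e. \<theta> i)"
    proof
      fix x assume "x \<in> Z"
      then obtain i where "i < e" "x \<in> \<Union>(\<epsilon> i)" using \<epsilon>(2) by blast
      then have "d + i < d + e" "x \<in> \<Union>(\<theta> (d + i))" by (auto simp: \<theta>_def)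
      then show "x \<in> \<Union>(\<Union>i<d + e. \<theta> i)" by blast
    qed
    ultimately show "\<exists>\<delta>. (\<forall>i<d + e. disjoint_refinement X (\<eta> i) (\<delta> i)) \<and>
        Y \<union> Z \<subseteq> \<Union>(\<Union>i<d + e. \<delta> i)"
      by blast
  qed
qed

lemma finitely_refinable_UN:
  assumes "finite I" "\<And>i. i \<in> I \<Longrightarrow> finitely_refinable X (Y i)"
  shows "finitely_refinable X (\<Union>i\<in>I. Y i)"
  using assms
  by (induction I) (simp_all add: finitely_refinable_empty finitely_refinable_Un)

lemma finitely_refinable_subset:
  assumes Z: "finitely_refinable X Z" and YZ: "Y \<subseteq> Z"
  shows "finitely_refinable X Y"
proof -
  obtain d where d: "\<forall>\<eta>::nat \<Rightarrow> 'a set set. (\<forall>i. locally_finite_cover X (\<eta> i)) \<longrightarrow>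
      (\<exists>\<delta>. (\<forall>i<d. disjoint_refinement X (\<eta> i) (\<delta> i)) \<and> Z \<subseteq> \<Union>(\<Union>i<d. \<delta> i))"
    using Z unfolding finitely_refinable_def ..
  show ?thesis
    unfolding finitely_refinable_def
  proof (intro exI[of _ d] allI impI)
    fix \<eta> :: "nat \<Rightarrow> 'a set set" assume "\<forall>i. locally_finite_cover X (\<eta> i)"
    then have "\<exists>\<delta>. (\<forall>i<d. disjoint_refinement X (\<eta> i) (\<delta> i)) \<and> Z \<subseteq> \<Union>(\<Union>i<d. \<delta> i)"
      using d by simp
    then show "\<exists>\<delta>. (\<forall>i<d. disjoint_refinement X (\<eta> i) (\<delta> i)) \<and> Y \<subseteq> \<Union>(\<Union>i<d. \<delta> i)"
      by (rule ex_forward) (use YZ in blast)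
  qed
qed

section \<open>Finite C-spaces\<close>

text \<open>A disjoint refinement of a binary cover splits into two disjoint cozero sets
  \<open>A l \<subseteq> U l\<close> and \<open>B l \<subseteq> U' l\<close>; the normalised
  difference of their witnesses serves as \<open>q l\<close>. This resembles inessentiality of the
  whole space, except that \<open>s\<close> is found only after the infinite sequence
  \<open>h\<close> is given.\<close>

lemma finite_C_space_binary_covers:
  fixes h :: "nat \<Rightarrow> 'a \<Rightarrow> real"
  assumes X: "finite_C_space X" and h: "\<And>l. continuous_map X euclideanreal (h l)"
  shows "\<exists>s q. (\<forall>l<s. continuous_map X euclideanreal (q l)) \<and>
    (\<forall>l<s. \<forall>x\<in>topspace X. (1 \<le> q l x \<longrightarrow> 0 < h l x) \<and> (q l x \<le> - 1 \<longrightarrow> h l x < 1)) \<and>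
    (\<forall>x\<in>topspace X. \<exists>l<s. 1 \<le> \<bar>q l x\<bar>)"
proof -
  define U where "U l = {x \<in> topspace X. 0 < h l x}" for l
  define U' where "U' l = {x \<in> topspace X. 0 < 1 - h l x}" for l
  have fo: "functionally_open X (U l)" "functionally_open X (U' l)" for l
    unfolding U_def U'_def using h
    by (intro functionally_open_positive continuous_map_diff; simp)+
  define \<omega> where "\<omega> l = {U l, U' l}" for l
  have "finite (\<omega> l) \<and> (\<forall>V\<in>\<omega> l. functionally_open X V) \<and> \<Union>(\<omega> l) = topspace X" for l
    using fo by (auto simp: \<omega>_def U_def U'_def)
  then have "\<exists>s \<gamma>. finite_C_refinement X \<omega> s \<gamma> \<and>
      (\<forall>n<s. finite (\<gamma> n) \<and> (\<forall>V\<in>\<gamma> n. functionally_open X V))"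
    using X unfolding finite_C_space_def by simp
  then obtain s \<gamma> where \<gamma>: "finite_C_refinement X \<omega> s \<gamma>"
    and fin: "\<And>l. l < s \<Longrightarrow> finite (\<gamma> l)"
    and fo\<gamma>: "\<And>l V. \<lbrakk>l < s; V \<in> \<gamma> l\<rbrakk> \<Longrightarrow> functionally_open X V"
    by auto
  have disj: "\<And>l. l < s \<Longrightarrow> pairwise disjnt (\<gamma> l)"
    and ref: "\<And>l V. \<lbrakk>l < s; V \<in> \<gamma> l\<rbrakk> \<Longrightarrow> V \<subseteq> U l \<or> V \<subseteq> U' l"
    and cov: "topspace X \<subseteq> \<Union>(\<Union>n<s. \<gamma> n)"
    using \<gamma> by (auto simp: finite_C_refinement_def refines_def \<omega>_def)
  define A where "A l = \<Union>{V \<in> \<gamma> l. V \<subseteq> U l}" for l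
  define B where "B l = \<Union>{V \<in> \<gamma> l. \<not> V \<subseteq> U l}" for l
  have foA: "functionally_open X (A l)" if "l \<in> {..<s}" for l
    unfolding A_def using that fin fo\<gamma> by (intro functionally_open_finite_Union) auto
  have foB: "functionally_open X (B l)" if "l \<in> {..<s}" for l
    unfolding B_def using that fin fo\<gamma> by (intro functionally_open_finite_Union) auto
  have AB: "\<not> (x \<in> A l \<and> x \<in> B l)" if "l < s" for l x
    using disj[OF that] by (auto simp: A_def B_def pairwise_def disjnt_def)
  obtain a where a: "(\<forall>l\<in>{..<s}. continuous_map X euclideanreal (a l)) \<and> (\<forall>l x. 0 \<le> a l x) \<and>
      (\<forall>l\<in>{..<s}. \<forall>x. x \<in> A l \<longleftrightarrow> x \<in> topspace X \<and> 0 < a l x)"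
    using functionally_open_family[of "{..<s}" X A, OF foA] ..
  obtain b where b: "(\<forall>l\<in>{..<s}. continuous_map X euclideanreal (b l)) \<and> (\<forall>l x. 0 \<le> b l x) \<and>
      (\<forall>l\<in>{..<s}. \<forall>x. x \<in> B l \<longleftrightarrow> x \<in> topspace X \<and> 0 < b l x)"
    using functionally_open_family[of "{..<s}" X B, OF foB] ..
  have conta: "continuous_map X euclideanreal (a l)" and contb: "continuous_map X euclideanreal (b l)"
    if "l < s" for l
    using a b that by auto
  have nonneg: "0 \<le> a l x" "0 \<le> b l x" for l x
    using a b by auto
  have memA: "x \<in> A l \<longleftrightarrow> x \<in> topspace X \<and> 0 < a l x"
    and memB: "x \<in> B l \<longleftrightarrow> x \<in> topspace X \<and> 0 < b l x" if "l < s" for l x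
    using a b that by auto
  define M where "M = (\<lambda>x. \<Sum>l<s. a l x + b l x)"
  have M: "continuous_map X euclideanreal M"
    unfolding M_def using conta contb by (intro continuous_map_sum continuous_map_add) auto
  have Mpos: "0 < M x" if x: "x \<in> topspace X" for x
  proof -
    obtain l V where l: "l < s" "V \<in> \<gamma> l" "x \<in> V" using cov x by blast
    then have "x \<in> A l \<or> x \<in> B l" by (auto simp: A_def B_def)
    then have "0 < a l x + b l x"
      using memA[OF l(1)] memB[OF l(1)] nonneg by (auto intro: add_pos_nonneg add_nonneg_pos)
    then show ?thesis
      unfolding M_def using l(1) nonneg by (intro sum_pos2[of _ l]) auto
  qed
  \<comment> \<open>One of the \<open>s\<close> summands of \<open>M\<close> is at least the average
    \<open>M / s\<close>, and the factor \<open>s\<close> raises its quotient to 1. As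
    \<open>A l\<close> and \<open>B l\<close> are disjoint, the difference \<open>a l - b l\<close>
    has the full absolute value of the sum.\<close>
  define q where "q l x = real s * (a l x - b l x) / M x" for l x
  have contq: "continuous_map X euclideanreal (q l)" if "l < s" for l
    unfolding q_def using conta[OF that] contb[OF that] M Mpos
    by (intro continuous_map_real_divide continuous_map_real_mult continuous_map_diff) force+
  have "0 < h l x" if l: "l < s" and x: "x \<in> topspace X" and 1: "1 \<le> q l x" for l x
  proof -
    have "0 < real s * (a l x - b l x)"
      using 1 Mpos[OF x] by (simp add: q_def pos_le_divide_eq)
    then have "0 < a l x" using nonneg[where l=l and x=x] by (simp add: zero_less_mult_iff)
    then have "x \<in> A l" using memA[OF l] x by simp
    then show ?thesis by (auto simp: A_def U_def)
  qed
  moreover have "h l x < 1" if l: "l < s" and x: "x \<in> topspace X" and 1: "q l x \<le> - 1" for l x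
  proof -
    have "real s * (a l x - b l x) < 0"
      using 1 Mpos[OF x] by (simp add: q_def pos_divide_le_eq)
    then have "0 < b l x" using nonneg[where l=l and x=x] by (simp add: mult_less_0_iff)
    then have "x \<in> B l" using memB[OF l] x by simp
    then obtain V where "V \<in> \<gamma> l" "\<not> V \<subseteq> U l" "x \<in> V" by (auto simp: B_def)
    then have "x \<in> U' l" using ref[OF l] by blast
    then show ?thesis by (simp add: U'_def)
  qed
  moreover have "\<exists>l<s. 1 \<le> \<bar>q l x\<bar>" if x: "x \<in> topspace X" for x
  proof (rule ccontr)
    assume "\<not> (\<exists>l<s. 1 \<le> \<bar>q l x\<bar>)"
    then have lt: "\<bar>q l x\<bar> < 1" if "l < s" for l using that by force
    have "real s * (a l x + b l x) < M x" if l: "l < s" for l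
    proof -
      have "\<bar>real s * (a l x - b l x)\<bar> < M x"
        using lt[OF l] Mpos[OF x] by (simp add: q_def abs_divide)
      moreover have "\<bar>a l x - b l x\<bar> = a l x + b l x"
        using AB[OF l, of x] memA[OF l, of x] memB[OF l, of x] x nonneg[where l=l and x=x] by auto
      ultimately show ?thesis by (simp add: abs_mult)
    qed
    moreover have "0 < s" using cov x by auto
    ultimately have "(\<Sum>l<s. real s * (a l x + b l x)) < (\<Sum>l<s. M x)"
      by (intro sum_strict_mono) auto
    then show False by (simp add: M_def sum_distrib_left)
  qed
  ultimately show ?thesis
    using contq by - (rule exI[of _ s], rule exI[of _ q], simp)
qed

section \<open>Gluing over separated slabs and the diagonal argument\<close>

text \<open>The set \<open>2 i \<le> g \<le> 2 i + 1\<close>, written as a distance from the centre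
  because the cutoffs depend on that distance. Gaps of length 1 between consecutive slabs leave room
  for the cutoffs.\<close>

definition slab :: "'a topology \<Rightarrow> ('a \<Rightarrow> real) \<Rightarrow> nat \<Rightarrow> 'a set" where
  "slab X g i = {x \<in> topspace X. \<bar>g x - (2 * real i + 1/2)\<bar> \<le> 1/2}"

text \<open>The cutoffs are 1 up to distance 3/4 from a centre and 0 from distance 1 on. As centres
  are at least 2 apart, at most one cutoff is nonzero at a point, so \<open>F\<close> is 0 or a
  damped copy of one \<open>f i\<close>. Agreement up to 3/4 rather than the slab radius 1/2 leaves
  a margin for a second cutoff.\<close>

lemma glue_over_slabs:
  fixes f :: "nat \<Rightarrow> 'a \<Rightarrow> real"
  assumes g: "continuous_map X euclideanreal g" and f: "\<And>i. continuous_map X euclideanreal (f i)"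
  shows "\<exists>F. continuous_map X euclideanreal F \<and>
    (\<forall>x\<in>topspace X. \<forall>i. \<bar>g x - (2 * real i + 1/2)\<bar> \<le> 3/4 \<longrightarrow> F x = f i x) \<and>
    (\<forall>x\<in>topspace X. F x = 0 \<or> (\<exists>i t. 0 < t \<and> t \<le> 1 \<and> F x = t * f i x))"
proof -
  define \<phi> where "\<phi> i x = max 0 (min 1 (4 - 4 * \<bar>g x - (2 * real i + 1/2)\<bar>))" for i x
  have \<phi>: "continuous_map X euclideanreal (\<phi> i)" for i
    unfolding \<phi>_def using g
    by (intro continuous_map_real_max continuous_map_real_min continuous_map_diff
        continuous_map_real_mult continuous_map_real_abs) auto
  have near: "\<bar>g x - (2 * real i + 1/2)\<bar> < 1" if "\<phi> i x \<noteq> 0" for i x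
    using that by (auto simp: \<phi>_def max_def min_def split: if_splits)
  have unique: "i = k" if "\<phi> i x \<noteq> 0" "\<phi> k x \<noteq> 0" for i k x
  proof -
    have "\<bar>2 * real i - 2 * real k\<bar> < 2"
      using near[OF that(1)] near[OF that(2)] by linarith
    then show ?thesis by linarith
  qed
  define F where "F = (\<lambda>x. supp_sum (\<lambda>i. \<phi> i x * f i x) UNIV)"
  have "continuous_map X euclideanreal (\<lambda>x. supp_sum (\<lambda>i. \<phi> i x * f i x) UNIV)"
  proof (rule continuous_map_supp_sum)
    show "continuous_map X euclideanreal (\<lambda>x. \<phi> i x * f i x)" for i
      using \<phi> f by (intro continuous_map_real_mult)
    fix x assume x: "x \<in> topspace X"
    define N where "N = {y \<in> topspace X. g y \<in> {..<g x + 1}}"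
    have "openin X N"
      unfolding N_def using g by (rule openin_continuous_map_preimage) simp
    moreover have "x \<in> N" using x by (simp add: N_def)
    moreover have "{i \<in> UNIV. \<exists>y\<in>N. \<phi> i y * f i y \<noteq> 0} \<subseteq> {..nat \<lceil>g x + 2\<rceil>}"
    proof
      fix i assume "i \<in> {i \<in> UNIV. \<exists>y\<in>N. \<phi> i y * f i y \<noteq> 0}"
      then obtain y where "y \<in> N" "\<phi> i y \<noteq> 0" by auto
      then have "2 * real i + 1/2 < g x + 2"
        using near[of i y] by (auto simp: N_def)
      then show "i \<in> {..nat \<lceil>g x + 2\<rceil>}" by simp linarith
    qed
    ultimately show "\<exists>N. openin X N \<and> x \<in> N \<and> finite {i \<in> UNIV. \<exists>y\<in>N. \<phi> i y * f i y \<noteq> 0}"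
      by (meson finite_atMost finite_subset)
  qed
  then have contF: "continuous_map X euclideanreal F"
    by (simp add: F_def)
  have Fi: "F x = \<phi> i x * f i x" if "\<phi> i x \<noteq> 0" for i x
  proof -
    have "support_on UNIV (\<lambda>i. \<phi> i x * f i x) \<subseteq> {i}"
      using unique[OF that] by (auto simp: support_on_def)
    then have "F x = (\<Sum>i\<in>{i}. \<phi> i x * f i x)"
      unfolding F_def supp_sum_def
      by (intro sum.mono_neutral_left) (auto simp: support_on_def)
    then show ?thesis by simp
  qed
  have F0: "F x = 0" if "\<And>i. \<phi> i x = 0" for x
    using that by (simp add: F_def supp_sum_def)
  show ?thesis
  proof (intro exI[of _ F] conjI ballI allI impI contF)
    fix x i assume "\<bar>g x - (2 * real i + 1/2)\<bar> \<le> 3/4"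
    then have "\<phi> i x = 1" by (simp add: \<phi>_def)
    then show "F x = f i x" using Fi[of i x] by simp
  next
    fix x
    show "F x = 0 \<or> (\<exists>i t. 0 < t \<and> t \<le> 1 \<and> F x = t * f i x)"
    proof (cases "\<forall>i. \<phi> i x = 0")
      case True
      then show ?thesis using F0 by simp
    next
      case False
      then obtain i where i: "\<phi> i x \<noteq> 0" by blast
      then have "0 < \<phi> i x" "\<phi> i x \<le> 1" by (auto simp: \<phi>_def)
      then show ?thesis using Fi[OF i] by blast
    qed
  qed
qed

text \<open>Since all slabs share the same \<open>m\<close>, their solutions \<open>q i\<close> for
  a given \<open>h\<close> can be glued. Damping is harmless: if \<open>t * q \<ge> 1\<close> with
  \<open>0 < t \<le> 1\<close>, then already \<open>q \<ge> 1\<close>, and likewise for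
  \<open>- 1\<close>.\<close>

lemma inessential_slabs:
  assumes g: "continuous_map X euclideanreal g"
    and ines: "\<And>i. j \<le> i \<Longrightarrow> inessential X m (slab X g i)"
  shows "inessential X m (\<Union>i\<in>{j..}. slab X g i)"
  unfolding inessential_def
proof (intro allI impI)
  fix h :: "nat \<Rightarrow> 'a \<Rightarrow> real" assume h: "\<forall>l<m. continuous_map X euclideanreal (h l)"
  have "\<forall>i. \<exists>q. (\<forall>l<m. continuous_map X euclideanreal (q l)) \<and>
    (\<forall>l<m. \<forall>x\<in>topspace X. (1 \<le> q l x \<longrightarrow> 0 < h l x) \<and> (q l x \<le> - 1 \<longrightarrow> h l x < 1)) \<and>
    (j \<le> i \<longrightarrow> (\<forall>x\<in>slab X g i. \<exists>l<m. 1 \<le> \<bar>q l x\<bar>))"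
  proof
    fix i
    show "\<exists>q. (\<forall>l<m. continuous_map X euclideanreal (q l)) \<and>
      (\<forall>l<m. \<forall>x\<in>topspace X. (1 \<le> q l x \<longrightarrow> 0 < h l x) \<and> (q l x \<le> - 1 \<longrightarrow> h l x < 1)) \<and>
      (j \<le> i \<longrightarrow> (\<forall>x\<in>slab X g i. \<exists>l<m. 1 \<le> \<bar>q l x\<bar>))"
    proof (cases "j \<le> i")
      case True
      then show ?thesis
        using ines[OF True, unfolded inessential_def, THEN spec, of h] h by simp
    next
      case False
      \<comment> \<open>The zero functions reach neither 1 nor - 1, so the constraints hold
        vacuously.\<close>
      then show ?thesis by (intro exI[of _ "\<lambda>_ _. 0"]) simp
    qed
  qed
  from choice[OF this] obtain q where q:
    "\<forall>i. (\<forall>l<m. continuous_map X euclideanreal (q i l)) \<and>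
    (\<forall>l<m. \<forall>x\<in>topspace X. (1 \<le> q i l x \<longrightarrow> 0 < h l x) \<and> (q i l x \<le> - 1 \<longrightarrow> h l x < 1)) \<and>
    (j \<le> i \<longrightarrow> (\<forall>x\<in>slab X g i. \<exists>l<m. 1 \<le> \<bar>q i l x\<bar>))" ..
  have "\<forall>l\<in>{..<m}. \<exists>F. continuous_map X euclideanreal F \<and>
    (\<forall>x\<in>topspace X. \<forall>i. \<bar>g x - (2 * real i + 1/2)\<bar> \<le> 3/4 \<longrightarrow> F x = q i l x) \<and>
    (\<forall>x\<in>topspace X. F x = 0 \<or> (\<exists>i t. 0 < t \<and> t \<le> 1 \<and> F x = t * q i l x))"
    using q by (intro ballI glue_over_slabs[OF g]) simp
  from bchoice[OF this] obtain F where F: "\<forall>l\<in>{..<m}. continuous_map X euclideanreal (F l) \<and>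
    (\<forall>x\<in>topspace X. \<forall>i. \<bar>g x - (2 * real i + 1/2)\<bar> \<le> 3/4 \<longrightarrow> F l x = q i l x) \<and>
    (\<forall>x\<in>topspace X. F l x = 0 \<or> (\<exists>i t. 0 < t \<and> t \<le> 1 \<and> F l x = t * q i l x))" ..
  have contF: "continuous_map X euclideanreal (F l)" if "l < m" for l
    using F that by simp
  have eqF: "F l x = q i l x"
    if "l < m" "x \<in> topspace X" "\<bar>g x - (2 * real i + 1/2)\<bar> \<le> 3/4" for l x i
    using F that by simp
  have scaledF: "F l x = 0 \<or> (\<exists>i t. 0 < t \<and> t \<le> 1 \<and> F l x = t * q i l x)"
    if "l < m" "x \<in> topspace X" for l x
    using F that by simp
  have sandwich: "(1 \<le> F l x \<longrightarrow> 0 < h l x) \<and> (F l x \<le> - 1 \<longrightarrow> h l x < 1)"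
    if l: "l < m" and x: "x \<in> topspace X" for l x
    using scaledF[OF l x]
  proof
    assume "\<exists>i t. 0 < t \<and> t \<le> 1 \<and> F l x = t * q i l x"
    then obtain i t where t: "0 < t" "t \<le> 1" "F l x = t * q i l x" by blast
    have *: "(1 \<le> q i l x \<longrightarrow> 0 < h l x) \<and> (q i l x \<le> - 1 \<longrightarrow> h l x < 1)"
      using q l x by simp
    have "1 \<le> q i l x" if "1 \<le> t * q i l x"
    proof (rule ccontr)
      assume "\<not> 1 \<le> q i l x"
      then have "t * q i l x < t * 1" using t(1) by (intro mult_strict_left_mono) auto
      then show False using that t(2) by linarith
    qed
    moreover have "q i l x \<le> - 1" if "t * q i l x \<le> - 1"
    proof (rule ccontr)
      assume "\<not> q i l x \<le> - 1"
      then have "t * (- 1) < t * q i l x" using t(1) by (intro mult_strict_left_mono) auto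
      then show False using that t(2) by linarith
    qed
    ultimately show ?thesis using * t(3) by simp
  qed simp
  have "\<exists>l<m. 1 \<le> \<bar>F l x\<bar>" if x: "x \<in> (\<Union>i\<in>{j..}. slab X g i)" for x
  proof -
    obtain i where i: "j \<le> i" "x \<in> slab X g i" using x by auto
    then obtain l where l: "l < m" "1 \<le> \<bar>q i l x\<bar>" using q by blast
    have "F l x = q i l x"
      using i(2) by (intro eqF[OF l(1)]) (auto simp: slab_def)
    then show ?thesis using l by auto
  qed
  then show "\<exists>q. (\<forall>l<m. continuous_map X euclideanreal (q l)) \<and>
    (\<forall>l<m. \<forall>x\<in>topspace X. (1 \<le> q l x \<longrightarrow> 0 < h l x) \<and> (q l x \<le> - 1 \<longrightarrow> h l x < 1)) \<and>
    (\<forall>x\<in>(\<Union>i\<in>{j..}. slab X g i). \<exists>l<m. 1 \<le> \<bar>q l x\<bar>)"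
    using contF sandwich by (intro exI[of _ F] conjI allI impI ballI) simp_all
qed

text \<open>Otherwise infinitely many slabs would carry bad systems of arbitrarily many binary covers. Placing
  systems of growing size on distinct slabs and gluing them yields one sequence of binary covers of
  \<open>X\<close> which contradicts the finite C-property.\<close>

lemma finite_C_space_inessential_slabs:
  fixes g :: "'a \<Rightarrow> real"
  assumes X: "finite_C_space X" and g: "continuous_map X euclideanreal g"
  shows "\<exists>j m. inessential X m (\<Union>i\<in>{j..}. slab X g i)"
proof (rule ccontr)
  assume no: "\<not> (\<exists>j m. inessential X m (\<Union>i\<in>{j..}. slab X g i))"
  \<comment> \<open>If from some \<open>j\<close> on all slabs were inessential for
    \<open>m\<close>, so would be their union; hence for every \<open>m\<close> there are bad slabs
    arbitrarily far out.\<close>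
  have bad: "\<exists>i\<ge>j. \<not> inessential X m (slab X g i)" for j m
    using no inessential_slabs[OF g, of j m] by blast
  \<comment> \<open>The \<open>n\<close>-th chosen slab is bad for systems of size \<open>n\<close>;
    strict growth makes the choice injective.\<close>
  have "\<exists>\<iota>. \<forall>n. \<not> inessential X n (slab X g (\<iota> n)) \<and> \<iota> n < \<iota> (Suc n)"
  proof (rule dependent_nat_choice)
    show "\<exists>i. \<not> inessential X 0 (slab X g i)" using bad by blast
    show "\<exists>k. \<not> inessential X (Suc n) (slab X g k) \<and> i < k" for i n
      using bad[of "Suc i" "Suc n"] by (auto simp: Suc_le_eq)
  qed
  then obtain \<iota> where \<iota>: "\<forall>n. \<not> inessential X n (slab X g (\<iota> n)) \<and> \<iota> n < \<iota> (Suc n)" ..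
  have inj: "inj \<iota>"
    using \<iota> by (intro strict_mono_imp_inj_on) (simp add: strict_mono_Suc_iff)
  have "\<forall>n. \<exists>h. (\<forall>l<n. continuous_map X euclideanreal (h l)) \<and>
    \<not> (\<exists>q. (\<forall>l<n. continuous_map X euclideanreal (q l)) \<and>
      (\<forall>l<n. \<forall>x\<in>topspace X. (1 \<le> q l x \<longrightarrow> 0 < h l x) \<and> (q l x \<le> - 1 \<longrightarrow> h l x < 1)) \<and>
      (\<forall>x\<in>slab X g (\<iota> n). \<exists>l<n. 1 \<le> \<bar>q l x\<bar>))"
    using \<iota> by (simp add: inessential_def)
  from choice[OF this] obtain h where h: "\<forall>n. (\<forall>l<n. continuous_map X euclideanreal (h n l)) \<and>
    \<not> (\<exists>q. (\<forall>l<n. continuous_map X euclideanreal (q l)) \<and>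
      (\<forall>l<n. \<forall>x\<in>topspace X. (1 \<le> q l x \<longrightarrow> 0 < h n l x) \<and> (q l x \<le> - 1 \<longrightarrow> h n l x < 1)) \<and>
      (\<forall>x\<in>slab X g (\<iota> n). \<exists>l<n. 1 \<le> \<bar>q l x\<bar>))" ..
  \<comment> \<open>For fixed \<open>l\<close> this collects the \<open>l\<close>-th function of
    every system that has one and fills the other places with zero. Off the range of
    \<open>\<iota>\<close> the number \<open>inv \<iota> i\<close> is arbitrary, and continuity
    still holds.\<close>
  define f where "f l i = (if l < inv \<iota> i then h (inv \<iota> i) l else (\<lambda>_. 0))" for l i
  have f: "continuous_map X euclideanreal (f l i)" for l i
    using h by (simp add: f_def)
  have f\<iota>: "f l (\<iota> n) = h n l" if "l < n" for l n
    using that by (simp add: f_def inv_f_f[OF inj])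
  have "\<forall>l. \<exists>F. continuous_map X euclideanreal F \<and>
    (\<forall>x\<in>topspace X. \<forall>i. \<bar>g x - (2 * real i + 1/2)\<bar> \<le> 3/4 \<longrightarrow> F x = f l i x) \<and>
    (\<forall>x\<in>topspace X. F x = 0 \<or> (\<exists>i t. 0 < t \<and> t \<le> 1 \<and> F x = t * f l i x))"
    by (intro allI glue_over_slabs[OF g] f)
  from choice[OF this] obtain F where F: "\<forall>l. continuous_map X euclideanreal (F l) \<and>
    (\<forall>x\<in>topspace X. \<forall>i. \<bar>g x - (2 * real i + 1/2)\<bar> \<le> 3/4 \<longrightarrow> F l x = f l i x) \<and>
    (\<forall>x\<in>topspace X. F l x = 0 \<or> (\<exists>i t. 0 < t \<and> t \<le> 1 \<and> F l x = t * f l i x))" ..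
  have contF: "continuous_map X euclideanreal (F l)" for l
    using F by simp
  \<comment> \<open>The diagonal: \<open>s\<close> answers the whole glued sequence, and on slab
    \<open>\<iota> s\<close> the first \<open>s\<close> glued functions are exactly the bad system
    of size \<open>s\<close>.\<close>
  obtain s where "\<exists>q. (\<forall>l<s. continuous_map X euclideanreal (q l)) \<and>
    (\<forall>l<s. \<forall>x\<in>topspace X. (1 \<le> q l x \<longrightarrow> 0 < F l x) \<and> (q l x \<le> - 1 \<longrightarrow> F l x < 1)) \<and>
    (\<forall>x\<in>topspace X. \<exists>l<s. 1 \<le> \<bar>q l x\<bar>)"
    using finite_C_space_binary_covers[OF X contF] ..
  then obtain q where "(\<forall>l<s. continuous_map X euclideanreal (q l)) \<and>
    (\<forall>l<s. \<forall>x\<in>topspace X. (1 \<le> q l x \<longrightarrow> 0 < F l x) \<and> (q l x \<le> - 1 \<longrightarrow> F l x < 1)) \<and>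
    (\<forall>x\<in>topspace X. \<exists>l<s. 1 \<le> \<bar>q l x\<bar>)" ..
  then have q: "\<And>l. l < s \<Longrightarrow> continuous_map X euclideanreal (q l)"
    "\<And>l x. \<lbrakk>l < s; x \<in> topspace X\<rbrakk> \<Longrightarrow>
      (1 \<le> q l x \<longrightarrow> 0 < F l x) \<and> (q l x \<le> - 1 \<longrightarrow> F l x < 1)"
    "\<And>x. x \<in> topspace X \<Longrightarrow> \<exists>l<s. 1 \<le> \<bar>q l x\<bar>"
    by simp_all
  \<comment> \<open>\<open>F l\<close> is known to agree with \<open>h s l\<close> only up to
    distance 3/4 from the centre, so \<open>q l\<close> is cut off to vanish beyond; up to distance
    1/2, on the slab itself, nothing changes.\<close>
  define \<psi> where "\<psi> x = max 0 (min 1 (3 - 4 * \<bar>g x - (2 * real (\<iota> s) + 1/2)\<bar>))" for x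
  have \<psi>: "continuous_map X euclideanreal \<psi>"
    unfolding \<psi>_def using g
    by (intro continuous_map_real_max continuous_map_real_min continuous_map_diff
        continuous_map_real_mult continuous_map_real_abs) auto
  have sandwich: "(1 \<le> q l x * \<psi> x \<longrightarrow> 0 < h s l x) \<and> (q l x * \<psi> x \<le> - 1 \<longrightarrow> h s l x < 1)"
    if l: "l < s" and x: "x \<in> topspace X" for l x
  proof (cases "\<psi> x = 0")
    case False
    then have "\<bar>g x - (2 * real (\<iota> s) + 1/2)\<bar> \<le> 3/4"
      by (auto simp: \<psi>_def max_def min_def split: if_splits)
    then have eq: "F l x = h s l x" using F x f\<iota>[OF l] by simp
    have \<psi>x: "0 < \<psi> x" "\<psi> x \<le> 1" using False by (auto simp: \<psi>_def)
    have "1 \<le> q l x" if "1 \<le> q l x * \<psi> x"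
    proof (rule ccontr)
      assume "\<not> 1 \<le> q l x"
      then have "q l x * \<psi> x < 1 * \<psi> x" using \<psi>x(1) by (intro mult_strict_right_mono) auto
      then show False using that \<psi>x(2) by linarith
    qed
    moreover have "q l x \<le> - 1" if "q l x * \<psi> x \<le> - 1"
    proof (rule ccontr)
      assume "\<not> q l x \<le> - 1"
      then have "(- 1) * \<psi> x < q l x * \<psi> x" using \<psi>x(1) by (intro mult_strict_right_mono) auto
      then show False using that \<psi>x(2) by linarith
    qed
    ultimately show ?thesis using q(2)[OF l x] eq by simp
  qed simp
  have covers: "\<exists>l<s. 1 \<le> \<bar>q l x * \<psi> x\<bar>" if "x \<in> slab X g (\<iota> s)" for x
  proof -
    have x: "x \<in> topspace X" and "\<psi> x = 1" using that by (auto simp: slab_def \<psi>_def)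
    then show ?thesis using q(3)[OF x] by simp
  qed
  have cont: "continuous_map X euclideanreal (\<lambda>x. q l x * \<psi> x)" if "l < s" for l
    using q(1)[OF that] \<psi> by (rule continuous_map_real_mult)
  have "\<exists>q. (\<forall>l<s. continuous_map X euclideanreal (q l)) \<and>
      (\<forall>l<s. \<forall>x\<in>topspace X. (1 \<le> q l x \<longrightarrow> 0 < h s l x) \<and> (q l x \<le> - 1 \<longrightarrow> h s l x < 1)) \<and>
      (\<forall>x\<in>slab X g (\<iota> s). \<exists>l<s. 1 \<le> \<bar>q l x\<bar>)"
    by (rule exI[of _ "\<lambda>l x. q l x * \<psi> x"]) (use cont sandwich covers in simp)
  then show False using h by blast
qed

text \<open>The intervals \<open>[2 i, 2 i + 1]\<close> give slabs of \<open>g\<close>, and the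
  intervals \<open>[2 i + 1, 2 i + 2]\<close> give slabs of \<open>g + 1\<close> with index
  \<open>i + 1\<close>, so the result for one parity is applied twice.\<close>

lemma finite_C_space_refinable_tail:
  fixes g :: "'a \<Rightarrow> real"
  assumes X: "finite_C_space X" and g: "continuous_map X euclideanreal g"
  shows "\<exists>J::nat. finitely_refinable X {x \<in> topspace X. real J \<le> g x}"
proof -
  obtain j m where "inessential X m (\<Union>i\<in>{j..}. slab X g i)"
    using finite_C_space_inessential_slabs[OF X g] by blast
  then have even: "finitely_refinable X (\<Union>i\<in>{j..}. slab X g i)"
    by (rule inessential_imp_finitely_refinable) (auto simp: slab_def)
  have g1: "continuous_map X euclideanreal (\<lambda>x. g x + 1)"
    using g by (intro continuous_map_add) auto
  obtain k n where "inessential X n (\<Union>i\<in>{k..}. slab X (\<lambda>x. g x + 1) i)"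
    using finite_C_space_inessential_slabs[OF X g1] by blast
  then have odd: "finitely_refinable X (\<Union>i\<in>{k..}. slab X (\<lambda>x. g x + 1) i)"
    by (rule inessential_imp_finitely_refinable) (auto simp: slab_def)
  \<comment> \<open>This bound makes the slab index at least \<open>j\<close> in the even case and
    at least \<open>k\<close> in the odd one.\<close>
  have "{x \<in> topspace X. real (2 * j + 2 * k) \<le> g x} \<subseteq>
      (\<Union>i\<in>{j..}. slab X g i) \<union> (\<Union>i\<in>{k..}. slab X (\<lambda>x. g x + 1) i)"
  proof
    fix x assume "x \<in> {x \<in> topspace X. real (2 * j + 2 * k) \<le> g x}"
    then have x: "x \<in> topspace X" "real (2 * j + 2 * k) \<le> g x" by auto
    define r where "r = nat \<lfloor>g x\<rfloor>"
    have "0 \<le> g x" using x(2) by linarith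
    then have r: "real r \<le> g x" "g x < real r + 1"
      unfolding r_def by linarith+
    have jk: "2 * j + 2 * k \<le> r" using x(2) unfolding r_def by linarith
    show "x \<in> (\<Union>i\<in>{j..}. slab X g i) \<union> (\<Union>i\<in>{k..}. slab X (\<lambda>x. g x + 1) i)"
    proof (cases "even r")
      case True
      then obtain i where i: "r = 2 * i" by (elim evenE)
      then have "real r = 2 * real i" by simp
      then have "\<bar>g x - (2 * real i + 1/2)\<bar> \<le> 1/2" using r by linarith
      then have "x \<in> slab X g i" using x(1) by (simp add: slab_def)
      moreover have "j \<le> i" using jk i by simp
      ultimately show ?thesis by auto
    next
      case False
      then obtain i where i: "r = 2 * i + 1" by (elim oddE)
      then have "real r + 1 = 2 * real (Suc i)" by simp
      then have "\<bar>g x + 1 - (2 * real (Suc i) + 1/2)\<bar> \<le> 1/2" using r by linarith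
      then have "x \<in> slab X (\<lambda>x. g x + 1) (Suc i)" using x(1) by (simp add: slab_def)
      moreover have "k \<le> Suc i" using jk i by simp
      ultimately show ?thesis by (intro UnI2 UN_I[of "Suc i"]) auto
    qed
  qed
  then show ?thesis
    using finitely_refinable_subset[OF finitely_refinable_Un[OF even odd]] by blast
qed

text \<open>The cover \<open>\<U> \<union> {T}\<close> is finite, so the finite C-property applies to it, and what is lost by
  discarding the sets refining \<open>T\<close> can be regained by finitely many further covers.\<close>

lemma finite_C_space_reduction:
  assumes X: "finite_C_space X" and \<eta>: "locally_finite_cover X \<eta>"
  shows "\<exists>\<U> T. finite \<U> \<and> (\<forall>U\<in>insert T \<U>. functionally_open X U) \<and>
    \<Union>(insert T \<U>) = topspace X \<and> finitely_refinable X T \<and>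
    (\<forall>\<gamma>. disjoint_refinement X \<U> \<gamma> \<longrightarrow>
      (\<exists>\<gamma>'. disjoint_refinement X \<eta> \<gamma>' \<and> \<Union>\<gamma>' = \<Union>\<gamma>))"
proof -
  obtain W :: "nat \<Rightarrow> 'a set" and g :: "'a \<Rightarrow> real" where
    foW: "\<And>k. functionally_open X (W k)" and g: "continuous_map X euclideanreal g"
    and "\<And>x. x \<in> topspace X \<Longrightarrow> 0 \<le> g x"
    and gW: "\<And>x j. \<lbrakk>x \<in> topspace X; g x < real j\<rbrakk> \<Longrightarrow> \<exists>k<j. x \<in> W k"
    and split: "\<And>\<gamma>. disjoint_refinement X (range W) \<gamma> \<Longrightarrow>
      \<exists>\<gamma>'. disjoint_refinement X \<eta> \<gamma>' \<and> \<Union>\<gamma>' = \<Union>\<gamma>"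
    using countable_reduction[OF \<eta>] by blast
  obtain J :: nat where J: "finitely_refinable X {x \<in> topspace X. real J \<le> g x}"
    using finite_C_space_refinable_tail[OF X g] by blast
  \<comment> \<open>The open tail can belong to a functionally open cover and lies inside the closed
    tail, which is known to be refinable.\<close>
  define T where "T = {x \<in> topspace X. 0 < g x - real J}"
  \<comment> \<open>Off \<open>T\<close> one has \<open>g \<le> J\<close>, hence
    \<open>g < J + 1\<close>, which is why the index \<open>J\<close> is included.\<close>
  define \<U> where "\<U> = W ` {..<Suc J}"
  have foT: "functionally_open X T"
    unfolding T_def using g by (intro functionally_open_positive continuous_map_diff) auto
  have "topspace X \<subseteq> \<Union>(insert T \<U>)"
  proof
    fix x assume x: "x \<in> topspace X"
    show "x \<in> \<Union>(insert T \<U>)"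
    proof (cases "real J < g x")
      case True
      then show ?thesis using x by (auto simp: T_def)
    next
      case False
      then obtain k where "k < Suc J" "x \<in> W k" using gW[OF x, of "Suc J"] by auto
      then show ?thesis by (auto simp: \<U>_def)
    qed
  qed
  then have "\<Union>(insert T \<U>) = topspace X"
    using foT foW functionally_open_subset by (fastforce simp: \<U>_def)
  moreover have "finitely_refinable X T"
    by (rule finitely_refinable_subset[OF J]) (auto simp: T_def)
  moreover have "\<exists>\<gamma>'. disjoint_refinement X \<eta> \<gamma>' \<and> \<Union>\<gamma>' = \<Union>\<gamma>" if "disjoint_refinement X \<U> \<gamma>" for \<gamma>
  proof (rule split[of \<gamma>])
    show "disjoint_refinement X (range W) \<gamma>"
      by (rule disjoint_refinement_trans[OF that]) (auto simp: refines_def \<U>_def)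
  qed
  ultimately show ?thesis
    using foT foW by - (rule exI[of _ \<U>], rule exI[of _ T], simp add: \<U>_def)
qed

lemma locally_finite_in_finite_UN:
  assumes "finite I" "\<And>i. i \<in> I \<Longrightarrow> locally_finite_in X (\<A> i)"
  shows "locally_finite_in X (\<Union>i\<in>I. \<A> i)"
  using assms
proof (induction I)
  case empty
  show ?case by (simp add: locally_finite_in_def) (use openin_topspace in blast)
next
  case (insert i I)
  have i: "locally_finite_in X (\<A> i)" and I: "locally_finite_in X (\<Union>i\<in>I. \<A> i)"
    using insert by auto
  show ?case
    unfolding locally_finite_in_def
  proof (intro conjI ballI)
    show "\<Union>(\<Union>i\<in>insert i I. \<A> i) \<subseteq> topspace X"
      using i I by (auto simp: locally_finite_in_def)
    fix x assume x: "x \<in> topspace X"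
    obtain M where M: "openin X M" "x \<in> M" "finite {U \<in> \<A> i. U \<inter> M \<noteq> {}}"
      using locally_finite_inE[OF i x] by blast
    obtain N where N: "openin X N" "x \<in> N" "finite {U \<in> (\<Union>i\<in>I. \<A> i). U \<inter> N \<noteq> {}}"
      using locally_finite_inE[OF I x] by blast
    have "finite {U \<in> (\<Union>i\<in>insert i I. \<A> i). U \<inter> (M \<inter> N) \<noteq> {}}"
      by (rule finite_subset[OF _ finite_UnI[OF M(3) N(3)]]) auto
    then show "\<exists>V. openin X V \<and> x \<in> V \<and> finite {U \<in> (\<Union>i\<in>insert i I. \<A> i). U \<inter> V \<noteq> {}}"
      using M N by (intro exI[of _ "M \<inter> N"]) auto
  qed
qed

lemma finite_C_space_locally_finite_refinement:
  fixes \<omega> :: "nat \<Rightarrow> 'a set set"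
  assumes X: "finite_C_space X" and \<omega>: "\<And>n. locally_finite_cover X (\<omega> n)"
  shows "\<exists>s \<gamma>. (\<forall>n<s. disjoint_refinement X (\<omega> n) (\<gamma> n)) \<and> topspace X \<subseteq> \<Union>(\<Union>n<s. \<gamma> n)"
proof -
  have "\<forall>n. \<exists>\<U> T. finite \<U> \<and> (\<forall>U\<in>insert T \<U>. functionally_open X U) \<and>
    \<Union>(insert T \<U>) = topspace X \<and> finitely_refinable X T \<and>
    (\<forall>\<gamma>. disjoint_refinement X \<U> \<gamma> \<longrightarrow>
      (\<exists>\<gamma>'. disjoint_refinement X (\<omega> n) \<gamma>' \<and> \<Union>\<gamma>' = \<Union>\<gamma>))"
    by (intro allI finite_C_space_reduction[OF X \<omega>])
  from choice[OF this] obtain \<U> where "\<forall>n. \<exists>T. finite (\<U> n) \<and>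
    (\<forall>U\<in>insert T (\<U> n). functionally_open X U) \<and>
    \<Union>(insert T (\<U> n)) = topspace X \<and> finitely_refinable X T \<and>
    (\<forall>\<gamma>. disjoint_refinement X (\<U> n) \<gamma> \<longrightarrow>
      (\<exists>\<gamma>'. disjoint_refinement X (\<omega> n) \<gamma>' \<and> \<Union>\<gamma>' = \<Union>\<gamma>))" ..
  from choice[OF this] obtain T where T: "\<forall>n. finite (\<U> n) \<and>
    (\<forall>U\<in>insert (T n) (\<U> n). functionally_open X U) \<and>
    \<Union>(insert (T n) (\<U> n)) = topspace X \<and> finitely_refinable X (T n) \<and>
    (\<forall>\<gamma>. disjoint_refinement X (\<U> n) \<gamma> \<longrightarrow>
      (\<exists>\<gamma>'. disjoint_refinement X (\<omega> n) \<gamma>' \<and> \<Union>\<gamma>' = \<Union>\<gamma>))" ..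
  define \<omega>' where "\<omega>' n = insert (T n) (\<U> n)" for n
  have "\<forall>n. finite (\<omega>' n) \<and> (\<forall>U\<in>\<omega>' n. functionally_open X U) \<and> \<Union>(\<omega>' n) = topspace X"
    using T by (simp add: \<omega>'_def)
  then have "\<exists>s \<gamma>. finite_C_refinement X \<omega>' s \<gamma> \<and>
      (\<forall>n<s. finite (\<gamma> n) \<and> (\<forall>V\<in>\<gamma> n. functionally_open X V))"
    using X unfolding finite_C_space_def by simp
  then obtain s \<gamma> where \<gamma>: "finite_C_refinement X \<omega>' s \<gamma>"
    and fin: "\<And>n. n < s \<Longrightarrow> finite (\<gamma> n)"
    and fo: "\<And>n V. \<lbrakk>n < s; V \<in> \<gamma> n\<rbrakk> \<Longrightarrow> functionally_open X V"
    by auto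
  have disj: "\<And>n. n < s \<Longrightarrow> pairwise disjnt (\<gamma> n)"
    and ref: "\<And>n V. \<lbrakk>n < s; V \<in> \<gamma> n\<rbrakk> \<Longrightarrow> V \<subseteq> T n \<or> (\<exists>U\<in>\<U> n. V \<subseteq> U)"
    and cov: "topspace X \<subseteq> \<Union>(\<Union>n<s. \<gamma> n)"
    using \<gamma> by (auto simp: finite_C_refinement_def refines_def \<omega>'_def)
  \<comment> \<open>The discarded members of \<open>\<gamma> n\<close> lie in
    \<open>T n\<close>.\<close>
  define \<alpha> where "\<alpha> n = {V \<in> \<gamma> n. \<exists>U\<in>\<U> n. V \<subseteq> U}" for n
  have \<alpha>: "disjoint_refinement X (\<U> n) (\<alpha> n)" if n: "n < s" for n
    unfolding disjoint_refinement_def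
  proof (intro conjI ballI)
    show "functionally_open X V" if "V \<in> \<alpha> n" for V
      using fo[OF n] that by (simp add: \<alpha>_def)
    show "pairwise disjnt (\<alpha> n)"
      using disj[OF n] by (rule pairwise_subset) (auto simp: \<alpha>_def)
    show "locally_finite_in X (\<alpha> n)"
      using fin[OF n] functionally_open_subset[OF fo[OF n]]
      by (intro finite_imp_locally_finite_in) (auto simp: \<alpha>_def)
    show "refines (\<alpha> n) (\<U> n)"
      by (auto simp: refines_def \<alpha>_def)
  qed
  have "\<forall>n\<in>{..<s}. \<exists>\<beta>. disjoint_refinement X (\<omega> n) \<beta> \<and> \<Union>\<beta> = \<Union>(\<alpha> n)"
    using T \<alpha> by simp
  from bchoice[OF this] obtain \<beta>
    where \<beta>: "\<forall>n\<in>{..<s}. disjoint_refinement X (\<omega> n) (\<beta> n) \<and> \<Union>(\<beta> n) = \<Union>(\<alpha> n)" ..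
  \<comment> \<open>With \<open>s\<close> now fixed, only finitely many tails remain, and the bound
    \<open>d\<close> for their union holds for the covers
    \<open>\<omega> s, \<omega> (s + 1), ...\<close> whatever these are.\<close>
  have "finitely_refinable X (\<Union>n\<in>{..<s}. T n)"
    using T by (intro finitely_refinable_UN) auto
  then obtain d where d: "\<forall>\<eta>::nat \<Rightarrow> 'a set set. (\<forall>i. locally_finite_cover X (\<eta> i)) \<longrightarrow>
      (\<exists>\<delta>. (\<forall>i<d. disjoint_refinement X (\<eta> i) (\<delta> i)) \<and>
        (\<Union>n\<in>{..<s}. T n) \<subseteq> \<Union>(\<Union>i<d. \<delta> i))"
    unfolding finitely_refinable_def ..
  obtain \<delta> where \<delta>: "\<forall>i<d. disjoint_refinement X (\<omega> (s + i)) (\<delta> i)"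
    "(\<Union>n\<in>{..<s}. T n) \<subseteq> \<Union>(\<Union>i<d. \<delta> i)"
    using d[THEN spec, of "\<lambda>i. \<omega> (s + i)"] \<omega> by auto
  define \<theta> where "\<theta> n = (if n < s then \<beta> n else \<delta> (n - s))" for n
  have "disjoint_refinement X (\<omega> n) (\<theta> n)" if "n < s + d" for n
  proof (cases "n < s")
    case True
    then show ?thesis using \<beta> by (simp add: \<theta>_def)
  next
    case False
    then show ?thesis using \<delta>(1)[THEN spec, of "n - s"] that by (simp add: \<theta>_def)
  qed
  moreover have "topspace X \<subseteq> \<Union>(\<Union>n<s + d. \<theta> n)"
  proof
    fix x assume "x \<in> topspace X"
    then obtain n V where n: "n < s" "V \<in> \<gamma> n" "x \<in> V" using cov by blast
    show "x \<in> \<Union>(\<Union>n<s + d. \<theta> n)"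
    proof (cases "V \<subseteq> T n")
      case True
      then have "x \<in> (\<Union>n\<in>{..<s}. T n)" using n by blast
      then obtain i P where i: "i < d" "P \<in> \<delta> i" "x \<in> P" using \<delta>(2) by blast
      then have "P \<in> \<theta> (s + i)" "s + i < s + d" by (auto simp: \<theta>_def)
      then show ?thesis using i(3) by blast
    next
      case False
      then have "V \<in> \<alpha> n" using ref[OF n(1,2)] n(2) by (simp add: \<alpha>_def)
      then have "x \<in> \<Union>(\<beta> n)" using \<beta> n by auto
      then obtain P where "P \<in> \<theta> n" "x \<in> P" using n(1) by (auto simp: \<theta>_def)
      then show ?thesis using n(1) by (meson UN_I UnionI lessThan_iff trans_less_add1)
    qed
  qed
  ultimately show ?thesis by - (rule exI[of _ "s + d"], rule exI[of _ \<theta>], simp)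
qed

section \<open>The converse: from locally finite refinements back to finite ones\<close>

text \<open>Grouping the members of \<open>\<gamma>\<close> by a chosen set of
  \<open>\<omega>\<close> containing them leaves at most as many groups as \<open>\<omega>\<close>
  has sets. The union of a group is functionally open because \<open>\<gamma>\<close> is locally
  finite.\<close>

lemma merge_disjoint_refinement:
  assumes \<gamma>: "disjoint_refinement X \<omega> \<gamma>" and "finite \<omega>"
  shows "\<exists>\<delta>. disjoint_refinement X \<omega> \<delta> \<and> finite \<delta> \<and> \<Union>\<delta> = \<Union>\<gamma>"
proof -
  have "\<forall>V\<in>\<gamma>. \<exists>U. U \<in> \<omega> \<and> V \<subseteq> U"
    using \<gamma> by (auto simp: disjoint_refinement_def refines_def)
  from bchoice[OF this] obtain \<kappa> where \<kappa>: "\<forall>V\<in>\<gamma>. \<kappa> V \<in> \<omega> \<and> V \<subseteq> \<kappa> V" ..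
  have disj: "pairwise disjnt \<gamma>" and lf: "locally_finite_in X \<gamma>"
    and fo\<gamma>: "\<And>V. V \<in> \<gamma> \<Longrightarrow> functionally_open X V"
    using \<gamma> by (auto simp: disjoint_refinement_def)
  define P where "P U = \<Union>{V \<in> \<gamma>. \<kappa> V = U}" for U
  have foP: "functionally_open X (P U)" for U
    unfolding P_def
    by (rule functionally_open_locally_finite_Union[OF locally_finite_in_subset[OF lf]])
      (use fo\<gamma> in auto)
  have "disjoint_refinement X \<omega> (P ` \<omega>)"
    unfolding disjoint_refinement_def
  proof (intro conjI ballI)
    show "functionally_open X Q" if "Q \<in> P ` \<omega>" for Q
      using that foP by auto
    show "locally_finite_in X (P ` \<omega>)"
      using assms(2) functionally_open_subset[OF foP]
      by (intro finite_imp_locally_finite_in) auto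
    show "refines (P ` \<omega>) \<omega>"
      unfolding refines_def
    proof
      fix Q assume "Q \<in> P ` \<omega>"
      then obtain U where U: "U \<in> \<omega>" "Q = P U" by auto
      then have "Q \<subseteq> U" using \<kappa> by (auto simp: P_def)
      then show "\<exists>U\<in>\<omega>. Q \<subseteq> U" using U(1) by blast
    qed
    show "pairwise disjnt (P ` \<omega>)"
    proof (intro pairwiseI)
      fix Q R assume "Q \<in> P ` \<omega>" "R \<in> P ` \<omega>" "Q \<noteq> R"
      then obtain U U' where U: "Q = P U" "R = P U'" "U \<noteq> U'" by auto
      have False if x: "x \<in> P U" "x \<in> P U'" for x
      proof -
        obtain V V' where V: "V \<in> \<gamma>" "\<kappa> V = U" "x \<in> V" "V' \<in> \<gamma>" "\<kappa> V' = U'" "x \<in> V'"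
          using x by (auto simp: P_def)
        then have "disjnt V V'" using disj U(3) by (auto simp: pairwise_def)
        then show False using V by (auto simp: disjnt_def)
      qed
      then show "disjnt Q R" using U by (auto simp: disjnt_def)
    qed
  qed
  moreover have "\<Union>(P ` \<omega>) = \<Union>\<gamma>"
    using \<kappa> by (auto simp: P_def)
  ultimately show ?thesis
    using assms(2) by (intro exI[of _ "P ` \<omega>"]) simp
qed

theorem theorem2p4:
  fixes X :: "'a topology"
  assumes "completely_regular_space X" and "t1_space X"
  shows "finite_C_space X \<longleftrightarrow>
    (\<forall>\<omega>::nat \<Rightarrow> 'a set set.
        (\<forall>n. locally_finite_in X (\<omega> n) \<and> (\<forall>U\<in>\<omega> n. functionally_open X U) \<and> \<Union>(\<omega> n) = topspace X)
        \<longrightarrow> (\<exists>s \<gamma>. finite_C_refinement X \<omega> s \<gamma> \<and>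
               locally_finite_in X (\<Union>n<s. \<gamma> n) \<and>
               (\<forall>V\<in>(\<Union>n<s. \<gamma> n). functionally_open X V)))"
proof (intro iffI allI impI)
  fix \<omega> :: "nat \<Rightarrow> 'a set set"
  assume X: "finite_C_space X"
    and "\<forall>n. locally_finite_in X (\<omega> n) \<and> (\<forall>U\<in>\<omega> n. functionally_open X U) \<and> \<Union>(\<omega> n) = topspace X"
  then have \<omega>: "\<And>n. locally_finite_cover X (\<omega> n)"
    by (simp add: locally_finite_cover_def)
  obtain s \<gamma> where \<gamma>: "\<And>n. n < s \<Longrightarrow> disjoint_refinement X (\<omega> n) (\<gamma> n)"
    "topspace X \<subseteq> \<Union>(\<Union>n<s. \<gamma> n)"
    using finite_C_space_locally_finite_refinement[of X \<omega>, OF X \<omega>] by auto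
  have "finite_C_refinement X \<omega> s \<gamma>"
    using \<gamma>
    by (auto simp: finite_C_refinement_def disjoint_refinement_def intro: functionally_open_openin)
  moreover have "locally_finite_in X (\<Union>n<s. \<gamma> n)"
    using \<gamma>(1) by (intro locally_finite_in_finite_UN) (auto simp: disjoint_refinement_def)
  moreover have "\<forall>V\<in>(\<Union>n<s. \<gamma> n). functionally_open X V"
    using \<gamma>(1) by (auto simp: disjoint_refinement_def)
  ultimately show "\<exists>s \<gamma>. finite_C_refinement X \<omega> s \<gamma> \<and> locally_finite_in X (\<Union>n<s. \<gamma> n) \<and>
      (\<forall>V\<in>(\<Union>n<s. \<gamma> n). functionally_open X V)"
    by blast
next
  assume b: "\<forall>\<omega>::nat \<Rightarrow> 'a set set.
        (\<forall>n. locally_finite_in X (\<omega> n) \<and> (\<forall>U\<in>\<omega> n. functionally_open X U) \<and> \<Union>(\<omega> n) = topspace X)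
        \<longrightarrow> (\<exists>s \<gamma>. finite_C_refinement X \<omega> s \<gamma> \<and>
               locally_finite_in X (\<Union>n<s. \<gamma> n) \<and>
               (\<forall>V\<in>(\<Union>n<s. \<gamma> n). functionally_open X V))"
  show "finite_C_space X"
    unfolding finite_C_space_def
  proof (intro allI impI)
    fix \<omega> :: "nat \<Rightarrow> 'a set set"
    assume \<omega>: "\<forall>n. finite (\<omega> n) \<and> (\<forall>U\<in>\<omega> n. functionally_open X U) \<and> \<Union>(\<omega> n) = topspace X"
    then have "\<forall>n. locally_finite_in X (\<omega> n) \<and> (\<forall>U\<in>\<omega> n. functionally_open X U) \<and>
        \<Union>(\<omega> n) = topspace X"
      by (simp add: finite_imp_locally_finite_in)
    then have "\<exists>s \<gamma>. finite_C_refinement X \<omega> s \<gamma> \<and> locally_finite_in X (\<Union>n<s. \<gamma> n) \<and>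
        (\<forall>V\<in>(\<Union>n<s. \<gamma> n). functionally_open X V)"
      using b by simp
    then obtain s \<gamma> where \<gamma>: "finite_C_refinement X \<omega> s \<gamma>"
      and lf: "locally_finite_in X (\<Union>n<s. \<gamma> n)"
      and fo: "\<forall>V\<in>(\<Union>n<s. \<gamma> n). functionally_open X V"
      by auto
    have dis: "disjoint_refinement X (\<omega> n) (\<gamma> n)" if n: "n < s" for n
      unfolding disjoint_refinement_def
    proof (intro conjI)
      show "locally_finite_in X (\<gamma> n)"
        using lf by (rule locally_finite_in_subset) (use n in auto)
    qed (use \<gamma> fo n in \<open>auto simp: finite_C_refinement_def\<close>)
    \<comment> \<open>The families supplied by the hypothesis may be infinite; grouping makes them
      finite without changing their unions.\<close>
    have "\<forall>n\<in>{..<s}. \<exists>\<delta>. disjoint_refinement X (\<omega> n) \<delta> \<and> finite \<delta> \<and> \<Union>\<delta> = \<Union>(\<gamma> n)"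
      using \<omega> by (intro ballI merge_disjoint_refinement dis) auto
    from bchoice[OF this] obtain \<delta> where
      \<delta>: "\<forall>n\<in>{..<s}. disjoint_refinement X (\<omega> n) (\<delta> n) \<and> finite (\<delta> n) \<and> \<Union>(\<delta> n) = \<Union>(\<gamma> n)" ..
    have "topspace X \<subseteq> \<Union>(\<Union>n<s. \<gamma> n)"
      using \<gamma> by (simp add: finite_C_refinement_def)
    also have "\<dots> = (\<Union>n<s. \<Union>(\<gamma> n))" by auto
    also have "\<dots> = (\<Union>n<s. \<Union>(\<delta> n))" using \<delta> by simp
    also have "\<dots> = \<Union>(\<Union>n<s. \<delta> n)" by auto
    finally have "finite_C_refinement X \<omega> s \<delta>"
      using \<delta>
      by (auto simp: finite_C_refinement_def disjoint_refinement_def intro: functionally_open_openin)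
    moreover have "\<forall>n<s. finite (\<delta> n) \<and> (\<forall>V\<in>\<delta> n. functionally_open X V)"
      using \<delta> by (simp add: disjoint_refinement_def)
    ultimately show "\<exists>s \<gamma>. finite_C_refinement X \<omega> s \<gamma> \<and>
        (\<forall>n<s. finite (\<gamma> n) \<and> (\<forall>V\<in>\<gamma> n. functionally_open X V))"
      by blast
  qed
qed

end
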